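(* Let $K$ be a field, $\dot E=(E,C,D)$ a bi-separated graph, $\mathcal{C}$ a connected component of the category $\mathbf{RG}(\dot E)$ of representation graphs for $\dot E$, and $(T_{\mathcal{C}},\zeta_{\mathcal{C}})$ the object of $\mathcal{C}$ constructed in the context. Then the right $L(\dot E)$-module $V(T_{\mathcal{C}},\zeta_{\mathcal{C}})$ is indecomposable.
   Context: Graphs. A (directed) graph is a quadruple $E=(E^0,E^1,s,r)$ with sets $E^0$ (vertices), $E^1$ (edges) and maps $s,r:E^1\to E^0$ (source, range). A graph homomorphism $\phi:F\to E$ is a pair of maps $\phi^0:F^0\to E^0$, $\phi^1:F^1\to E^1$ with $s(\phi^1(e))=\phi^0(s(e))$, $r(\phi^1(e))=\phi^0(r(e))$; both are written $\phi$. The double graph $\hat E$ has vertex set $E^0$ and edges $e,e^*$ ($e\in E^1$), with $e$ as in $E$ and $e^*$ having source $r(e)$ and range $s(e)$. A walk in $E$ is a path in $\hat E$: either a single vertex (trivial walk) or a finite nonempty sequence $x_1\dots x_n$ of edges of $\hat E$ with $r(x_i)=s(x_{i+1})$. All graphs are assumed to have at least one vertex and to be connected, i.e. for all vertices $u,v$ there is a walk from $u$ to $v$. Coverings. A covering of a graph $E$ is a pair $(F,\phi)$ with $\phi:F\to E$ a graph homomorphism such that for every $v\in F^0$ the restrictions $\phi^1:s^{-1}(v)\to s^{-1}(\phi^0(v))$ and $\phi^1:r^{-1}(v)\to r^{-1}(\phi^0(v))$ are bijective. A morphism of coverings $(F,\phi)\to(G,\psi)$ is a graph homomorphism $\alpha:F\to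 G$ with $\psi\circ\alpha=\phi$. A covering of $E$ is universal if it admits a morphism to every covering of $E$; every (connected) graph has a universal covering. Bi-separated graphs. A bi-separated graph is a triple $\dot E=(E,C,D)$ with $E$ a graph, $C=\bigsqcup_{v\in E^0}C_v$ with $C_v$ a partition of $s^{-1}(v)$, $D=\bigsqcup_{v\in E^0}D_v$ with $D_v$ a partition of $r^{-1}(v)$, and $|X\cap Y|\le 1$ for all $X\in C$, $Y\in D$. All bi-separated graphs are assumed finitely bi-separated: every $X\in C$ and every $Y\in D$ is a finite set. For $X\in C$, $s(X)$ is the common source of the edges in $X$; for $Y\in D$, $r(Y)$ is the common range of the edges in $Y$; $XY=YX:=e$ if $X\cap Y=\{e\}$ and $XY=YX:=0$ if $X\cap Y=\emptyset$ (with $0^*=0$). Leavitt path algebra. For a field $K$, algebras are associative, not necessarily unital. The path algebra $P(\hat E)$ of $\hat E$ is the $K$-algebra generated by the vertices and edges of $\hat E$ with relations $uv=\delta_{uv}u$ for vertices and $s(x)x=x=xr(x)$ for edges (source and range in $\hat E$). $L(\dot E)$ is the quotient of $P(\hat E)$ by the relations (L1) $\sum_{Y\in D}(XY)(YX')^*=\delta_{XX'}s(X)$ for $X,X'\in C$ and (L2) $\sum_{X\in C}(YX)^*(XY')=\delta_{YY'}r(Y)$ for $Y,Y'\in D$. Representation graphs. A representation graph for $\dot E$ is a pair $(F,\phi)$ with $F$ a graph and $\phi:F\to E$ a graph homomorphism such that (i) for any $w\in F^0$ and $X\in C_{\phi(w)}$ there is precisely one $f\in s^{-1}(w)$ with $\phi(f)\in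 X$; (ii) for any $w\in F^0$ and $Y\in D_{\phi(w)}$ there is precisely one $f\in r^{-1}(w)$ with $\phi(f)\in Y$. $\mathbf{RG}(\dot E)$ is the category of representation graphs for $\dot E$; a morphism $(F,\phi)\to(G,\psi)$ is a graph homomorphism $\alpha:F\to G$ with $\psi\circ\alpha=\phi$. The connected components of a category are the full subcategories on the classes of objects linked by finite zigzags of morphisms. The object $(T_{\mathcal C},\zeta_{\mathcal C})$. For a connected component $\mathcal{C}$ choose an object $(F,\phi)$ of $\mathcal{C}$ and a universal covering $(T,\tau)$ of $F$. Then $(T_{\mathcal{C}},\zeta_{\mathcal{C}}):=(T,\phi\circ\tau)$, which is an object of $\mathcal{C}$. The module $V(F,\phi)$ of a representation graph. $V(F,\phi)$ is the $K$-vector space with basis $F^0$. For $v\in E^0$, $e\in E^1$ and $w\in F^0$ put $\sigma_v(w)=w$ if $\phi(w)=v$ and $0$ otherwise; $\sigma_e(w)=r(f)$ if there is $f\in F^1$ with $s(f)=w$, $\phi(f)=e$, and $0$ otherwise; $\sigma_{e^*}(w)=s(f)$ if there is $f\in F^1$ with $r(f)=w$, $\phi(f)=e$, and $0$ otherwise (such $f$ is unique). There is a unique $K$-algebra homomorphism $\pi:L(\dot E)\to\operatorname{End}_K(V(F,\phi))^{\rm op}$ with $\pi(v)=\sigma_v$, $\pi(e)=\sigma_e$, $\pi(e^* )=\sigma_{e^*}$, and $V(F,\phi)$ is a right $L(\dot E)$-module via $x.a:=\pi(a)(x)$. A module is indecomposable if it is nonzero and cannot be written as a direct sum of two nonzero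 submodules. *)

theory Defs
  imports
    "Graph_Theory.Arc_Walk"
    "HOL-Library.Poly_Mapping"
    "HOL-Library.Disjoint_Sets"
    "HOL-Library.FuncSet"
begin

section \<open>Graphs, coverings\<close>

text \<open>
  Directed graphs (multigraphs, possibly infinite) are those of \<^theory>\<open>Graph_Theory.Digraph\<close>;
  \<^const>\<open>tail\<close> is the source map and \<^const>\<open>head\<close> the range map.
\<close>

datatype 'e dedge = Edge 'e | Ghost 'e

definition double_graph :: "('v,'e) pre_digraph \<Rightarrow> ('v,'e dedge) pre_digraph" where
  "double_graph E = \<lparr> verts = verts E, arcs = Edge ` arcs E \<union> Ghost ` arcs E,
     tail = (\<lambda>x. case x of Edge e \<Rightarrow> tail E e | Ghost e \<Rightarrow> head E e),
     head = (\<lambda>x. case x of Edge e \<Rightarrow> head E e | Ghost e \<Rightarrow> tail E e) \<rparr>"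

definition connected_graph :: "('v,'e) pre_digraph \<Rightarrow> bool" where
  "connected_graph E \<longleftrightarrow> wf_digraph E \<and> verts E \<noteq> {} \<and>
     (\<forall>u\<in>verts E. \<forall>v\<in>verts E. \<exists>p. pre_digraph.awalk (double_graph E) u p v)"

record ('v,'e,'w,'f) graph_map =
  vmap :: "'v \<Rightarrow> 'w"
  amap :: "'e \<Rightarrow> 'f"

definition graph_hom ::
  "('v,'e) pre_digraph \<Rightarrow> ('w,'f) pre_digraph \<Rightarrow> ('v,'e,'w,'f) graph_map \<Rightarrow> bool" where
  "graph_hom F E \<phi> \<longleftrightarrow> vmap \<phi> \<in> verts F \<rightarrow> verts E \<and> amap \<phi> \<in> arcs F \<rightarrow> arcs E \<and>
     (\<forall>f\<in>arcs F. tail E (amap \<phi> f) = vmap \<phi> (tail F f) \<and> head E (amap \<phi> f) = vmap \<phi> (head F f))"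

definition comp_map ::
  "('w,'f,'u,'d) graph_map \<Rightarrow> ('v,'e,'w,'f) graph_map \<Rightarrow> ('v,'e,'u,'d) graph_map" where
  "comp_map \<psi> \<alpha> = \<lparr> vmap = vmap \<psi> \<circ> vmap \<alpha>, amap = amap \<psi> \<circ> amap \<alpha> \<rparr>"

text \<open>Morphisms over a common base graph, used both for coverings and for representation graphs;
  \<open>\<psi> \<circ> \<alpha> = \<phi>\<close> is required on the vertices and edges of \<open>F\<close> only.\<close>

definition morphism_over ::
  "('v,'e) pre_digraph \<Rightarrow> ('v,'e,'u,'d) graph_map \<Rightarrow>
   ('w,'f) pre_digraph \<Rightarrow> ('w,'f,'u,'d) graph_map \<Rightarrow> ('v,'e,'w,'f) graph_map \<Rightarrow> bool" where
  "morphism_over F \<phi> G \<psi> \<alpha> \<longleftrightarrow> graph_hom F G \<alpha> \<and>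
     (\<forall>v\<in>verts F. vmap (comp_map \<psi> \<alpha>) v = vmap \<phi> v) \<and>
     (\<forall>e\<in>arcs F. amap (comp_map \<psi> \<alpha>) e = amap \<phi> e)"

definition covering ::
  "('v,'e) pre_digraph \<Rightarrow> ('w,'f) pre_digraph \<Rightarrow> ('w,'f,'v,'e) graph_map \<Rightarrow> bool" where
  "covering E F \<phi> \<longleftrightarrow> connected_graph F \<and> graph_hom F E \<phi> \<and>
     (\<forall>v\<in>verts F. bij_betw (amap \<phi>) (out_arcs F v) (out_arcs E (vmap \<phi> v)) \<and>
                  bij_betw (amap \<phi>) (in_arcs F v) (in_arcs E (vmap \<phi> v)))"

text \<open>
  A bound variable cannot range over graphs of all types.  It suffices to test universality on
  coverings whose vertices are lists of edges of the double graph and whose edges are pairs of such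
  a list and an edge of \<open>E\<close>: every covering of a connected graph \<open>E\<close> is isomorphic to one of these
  (name a vertex by the image of a walk leading to it from a base point).  Lemma
  \<open>universal_covering_morphism\<close> below shows that one then has morphisms to coverings of every type.
\<close>

definition universal_covering ::
  "('v,'e) pre_digraph \<Rightarrow> ('t,'g) pre_digraph \<Rightarrow> ('t,'g,'v,'e) graph_map \<Rightarrow> bool" where
  "universal_covering E T \<tau> \<longleftrightarrow> covering E T \<tau> \<and>
     (\<forall>(G :: ('e dedge list, 'e dedge list \<times> 'e) pre_digraph) \<psi>.
        covering E G \<psi> \<longrightarrow> (\<exists>\<alpha>. morphism_over T \<tau> G \<psi> \<alpha>))"


section \<open>Bi-separated graphs and representation graphs\<close>

record ('v,'e) bisep_graph =
  graph_of :: "('v,'e) pre_digraph"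
  Cpart :: "'v \<Rightarrow> 'e set set"
  Dpart :: "'v \<Rightarrow> 'e set set"

definition Call :: "('v,'e) bisep_graph \<Rightarrow> 'e set set" where
  "Call B = (\<Union>v\<in>verts (graph_of B). Cpart B v)"

definition Dall :: "('v,'e) bisep_graph \<Rightarrow> 'e set set" where
  "Dall B = (\<Union>v\<in>verts (graph_of B). Dpart B v)"

definition bi_separated :: "('v,'e) bisep_graph \<Rightarrow> bool" where
  "bi_separated B \<longleftrightarrow> connected_graph (graph_of B) \<and>
     (\<forall>v\<in>verts (graph_of B). partition_on (out_arcs (graph_of B) v) (Cpart B v)) \<and>
     (\<forall>v\<in>verts (graph_of B). partition_on (in_arcs (graph_of B) v) (Dpart B v)) \<and>
     (\<forall>X\<in>Call B. finite X) \<and> (\<forall>Y\<in>Dall B. finite Y) \<and>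
     (\<forall>X\<in>Call B. \<forall>Y\<in>Dall B. card (X \<inter> Y) \<le> 1)"

definition representation_graph ::
  "('v,'e) bisep_graph \<Rightarrow> ('w,'f) pre_digraph \<Rightarrow> ('w,'f,'v,'e) graph_map \<Rightarrow> bool" where
  "representation_graph B F \<phi> \<longleftrightarrow> connected_graph F \<and> graph_hom F (graph_of B) \<phi> \<and>
     (\<forall>w\<in>verts F. \<forall>X\<in>Cpart B (vmap \<phi> w). \<exists>!f. f \<in> out_arcs F w \<and> amap \<phi> f \<in> X) \<and>
     (\<forall>w\<in>verts F. \<forall>Y\<in>Dpart B (vmap \<phi> w). \<exists>!f. f \<in> in_arcs F w \<and> amap \<phi> f \<in> Y)"

type_synonym ('w,'f,'v,'e) graph_over = "('w,'f) pre_digraph \<times> ('w,'f,'v,'e) graph_map"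

definition RG :: "('v,'e) bisep_graph \<Rightarrow> ('w,'f,'v,'e) graph_over set" where
  "RG B = {(F, \<phi>). representation_graph B F \<phi>}"

definition RG_morphisms ::
  "('v,'e) bisep_graph \<Rightarrow> (('w,'f,'v,'e) graph_over \<times> ('w,'f,'v,'e) graph_over) set" where
  "RG_morphisms B =
     {((F, \<phi>), (G, \<psi>)) | F \<phi> G \<psi>. (F, \<phi>) \<in> RG B \<and> (G, \<psi>) \<in> RG B \<and> (\<exists>\<alpha>. morphism_over F \<phi> G \<psi> \<alpha>)}"

text \<open>A connected component, being a full subcategory, is given by its class of objects.\<close>

definition RG_components :: "('v,'e) bisep_graph \<Rightarrow> ('w,'f,'v,'e) graph_over set set" where
  "RG_components B = RG B // (RG_morphisms B \<union> (RG_morphisms B)\<inverse>)\<^sup>*"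

text \<open>\<open>(T, \<zeta>)\<close> arises as \<open>(T\<^sub>\<C>, \<zeta>\<^sub>\<C>)\<close> from some choice of \<open>(F, \<phi>)\<close> in the component and
  of a universal covering of \<open>F\<close>.\<close>

definition is_T_zeta ::
  "('w,'f,'v,'e) graph_over set \<Rightarrow> ('t,'g) pre_digraph \<Rightarrow> ('t,'g,'v,'e) graph_map \<Rightarrow> bool" where
  "is_T_zeta \<C> T \<zeta> \<longleftrightarrow>
     (\<exists>F \<phi> \<tau>. (F, \<phi>) \<in> \<C> \<and> universal_covering F T \<tau> \<and> \<zeta> = comp_map \<phi> \<tau>)"


section \<open>Algebras over a field given by generators and relations\<close>

record ('a,'k) kalgebra =
  kcarrier :: "'a set"
  kadd :: "'a \<Rightarrow> 'a \<Rightarrow> 'a"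
  kmult :: "'a \<Rightarrow> 'a \<Rightarrow> 'a"
  ksmult :: "'k \<Rightarrow> 'a \<Rightarrow> 'a"

definition kalgebra_hom :: "('a,'k) kalgebra \<Rightarrow> ('b,'k) kalgebra \<Rightarrow> ('a \<Rightarrow> 'b) \<Rightarrow> bool" where
  "kalgebra_hom A B f \<longleftrightarrow> f \<in> kcarrier A \<rightarrow> kcarrier B \<and>
     (\<forall>x\<in>kcarrier A. \<forall>y\<in>kcarrier A. f (kadd A x y) = kadd B (f x) (f y)) \<and>
     (\<forall>x\<in>kcarrier A. \<forall>y\<in>kcarrier A. f (kmult A x y) = kmult B (f x) (f y)) \<and>
     (\<forall>c. \<forall>x\<in>kcarrier A. f (ksmult A c x) = ksmult B c (f x))"

definition scale :: "'k::field \<Rightarrow> ('a \<Rightarrow>\<^sub>0 'k) \<Rightarrow> ('a \<Rightarrow>\<^sub>0 'k)" where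
  "scale c x = Poly_Mapping.map ((*) c) x"

text \<open>Words under concatenation, written additively so that multiplication in
  \<open>'x free_monoid \<Rightarrow>\<^sub>0 'k\<close> is that of the monoid algebra.\<close>

datatype 'x free_monoid = Word (letters: "'x list")

instantiation free_monoid :: (type) monoid_add
begin
definition zero_free_monoid :: "'a free_monoid" where "0 = Word []"
definition plus_free_monoid :: "'a free_monoid \<Rightarrow> 'a free_monoid \<Rightarrow> 'a free_monoid" where
  "u + v = Word (letters u @ letters v)"
instance by standard (auto simp: zero_free_monoid_def plus_free_monoid_def)
end

text \<open>Algebras need not be unital, so the free algebra on \<open>X\<close> has only the nonempty words as basis.\<close>

definition free_algebra :: "'x set \<Rightarrow> ('x free_monoid \<Rightarrow>\<^sub>0 'k::field) set" where
  "free_algebra X = {a. \<forall>w\<in>Poly_Mapping.keys a. letters w \<noteq> [] \<and> set (letters w) \<subseteq> X}"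

definition gen :: "'x \<Rightarrow> ('x free_monoid \<Rightarrow>\<^sub>0 'k::field)" where
  "gen x = Poly_Mapping.single (Word [x]) 1"

inductive_set ideal_gen ::
  "'x set \<Rightarrow> ('x free_monoid \<Rightarrow>\<^sub>0 'k::field) set \<Rightarrow> ('x free_monoid \<Rightarrow>\<^sub>0 'k) set"
  for X R where
  rel: "r \<in> R \<Longrightarrow> r \<in> ideal_gen X R"
| zero: "0 \<in> ideal_gen X R"
| add: "a \<in> ideal_gen X R \<Longrightarrow> b \<in> ideal_gen X R \<Longrightarrow> a + b \<in> ideal_gen X R"
| scale: "a \<in> ideal_gen X R \<Longrightarrow> scale c a \<in> ideal_gen X R"
| left: "a \<in> ideal_gen X R \<Longrightarrow> u \<in> free_algebra X \<Longrightarrow> u * a \<in> ideal_gen X R"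
| right: "a \<in> ideal_gen X R \<Longrightarrow> u \<in> free_algebra X \<Longrightarrow> a * u \<in> ideal_gen X R"

definition coset :: "'x set \<Rightarrow> ('x free_monoid \<Rightarrow>\<^sub>0 'k::field) set \<Rightarrow>
    ('x free_monoid \<Rightarrow>\<^sub>0 'k) \<Rightarrow> ('x free_monoid \<Rightarrow>\<^sub>0 'k) set" where
  "coset X R a = {b. b - a \<in> ideal_gen X R}"

definition presented_algebra :: "'x set \<Rightarrow> ('x free_monoid \<Rightarrow>\<^sub>0 'k::field) set \<Rightarrow>
    (('x free_monoid \<Rightarrow>\<^sub>0 'k) set, 'k) kalgebra" where
  "presented_algebra X R = \<lparr>
     kcarrier = coset X R ` free_algebra X,
     kadd = (\<lambda>U V. \<Union>u\<in>U. \<Union>v\<in>V. coset X R (u + v)),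
     kmult = (\<lambda>U V. \<Union>u\<in>U. \<Union>v\<in>V. coset X R (u * v)),
     ksmult = (\<lambda>c U. \<Union>u\<in>U. coset X R (scale c u)) \<rparr>"


section \<open>Path algebras and the algebra \<open>L\<close> of a bi-separated graph\<close>

definition path_gens :: "('v,'x) pre_digraph \<Rightarrow> ('v + 'x) set" where
  "path_gens G = Inl ` verts G \<union> Inr ` arcs G"

definition path_rels :: "('v,'x) pre_digraph \<Rightarrow> (('v + 'x) free_monoid \<Rightarrow>\<^sub>0 'k::field) set" where
  "path_rels G =
     {gen (Inl u) * gen (Inl v) - (if u = v then gen (Inl u) else 0) | u v. u \<in> verts G \<and> v \<in> verts G}
   \<union> {gen (Inl (tail G x)) * gen (Inr x) - gen (Inr x) | x. x \<in> arcs G}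
   \<union> {gen (Inr x) * gen (Inl (head G x)) - gen (Inr x) | x. x \<in> arcs G}"

type_synonym ('v,'e,'k) Lfree = "('v + 'e dedge) free_monoid \<Rightarrow>\<^sub>0 'k"

definition source_of :: "('v,'e) bisep_graph \<Rightarrow> 'e set \<Rightarrow> 'v" where
  "source_of B X = (THE v. \<forall>e\<in>X. tail (graph_of B) e = v)"

definition range_of :: "('v,'e) bisep_graph \<Rightarrow> 'e set \<Rightarrow> 'v" where
  "range_of B Y = (THE v. \<forall>e\<in>Y. head (graph_of B) e = v)"

definition XY :: "'e set \<Rightarrow> 'e set \<Rightarrow> ('v,'e,'k::field) Lfree" where
  "XY X Y = (if X \<inter> Y = {} then 0 else gen (Inr (Edge (THE e. e \<in> X \<inter> Y))))"

definition XY_star :: "'e set \<Rightarrow> 'e set \<Rightarrow> ('v,'e,'k::field) Lfree" where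
  "XY_star X Y = (if X \<inter> Y = {} then 0 else gen (Inr (Ghost (THE e. e \<in> X \<inter> Y))))"

text \<open>\<open>D\<close> and \<open>C\<close> may be infinite, so the sums over \<open>Y \<in> D\<close> and \<open>X \<in> C\<close> in the relations are
  restricted to the finitely many indices for which the first factor is nonzero.\<close>

definition L1_rels :: "('v,'e) bisep_graph \<Rightarrow> ('v,'e,'k::field) Lfree set" where
  "L1_rels B =
     {(\<Sum>Y | Y \<in> Dall B \<and> X \<inter> Y \<noteq> {}. XY X Y * XY_star Y X')
        - (if X = X' then gen (Inl (source_of B X)) else 0)
      | X X'. X \<in> Call B \<and> X' \<in> Call B}"

definition L2_rels :: "('v,'e) bisep_graph \<Rightarrow> ('v,'e,'k::field) Lfree set" where
  "L2_rels B =
     {(\<Sum>X | X \<in> Call B \<and> Y \<inter> X \<noteq> {}. XY_star Y X * XY X Y')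
        - (if Y = Y' then gen (Inl (range_of B Y)) else 0)
      | Y Y'. Y \<in> Dall B \<and> Y' \<in> Dall B}"

text \<open>The path algebra of the double graph is \<^term>\<open>presented_algebra (path_gens G) (path_rels G)\<close> for
  \<^term>\<open>G = double_graph (graph_of B)\<close>; its quotient by (L1) and (L2) is obtained by adding
  these to the relators.\<close>

definition L_gens :: "('v,'e) bisep_graph \<Rightarrow> ('v + 'e dedge) set" where
  "L_gens B = path_gens (double_graph (graph_of B))"

definition L_rels :: "('v,'e) bisep_graph \<Rightarrow> ('v,'e,'k::field) Lfree set" where
  "L_rels B = path_rels (double_graph (graph_of B)) \<union> L1_rels B \<union> L2_rels B"

definition Lalg :: "('v,'e) bisep_graph \<Rightarrow> (('v,'e,'k::field) Lfree set, 'k) kalgebra" where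
  "Lalg B = presented_algebra (L_gens B) (L_rels B)"

definition Lgen :: "('v,'e) bisep_graph \<Rightarrow> 'v + 'e dedge \<Rightarrow> ('v,'e,'k::field) Lfree set" where
  "Lgen B g = coset (L_gens B) (L_rels B) (gen g)"


section \<open>The module of a representation graph\<close>

definition Vspace :: "('w,'f) pre_digraph \<Rightarrow> ('w \<Rightarrow>\<^sub>0 'k::field) set" where
  "Vspace F = {x. Poly_Mapping.keys x \<subseteq> verts F}"

text \<open>Linear extension of a map defined on the basis; a basis vector \<open>w\<close> is
  \<^term>\<open>Poly_Mapping.single w 1\<close>.\<close>

definition lin_ext :: "('a \<Rightarrow> ('b \<Rightarrow>\<^sub>0 'k::field)) \<Rightarrow> ('a \<Rightarrow>\<^sub>0 'k) \<Rightarrow> ('b \<Rightarrow>\<^sub>0 'k)" where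
  "lin_ext b x = (\<Sum>w\<in>Poly_Mapping.keys x. scale (Poly_Mapping.lookup x w) (b w))"

fun sigma :: "('w,'f) pre_digraph \<Rightarrow> ('w,'f,'v,'e) graph_map \<Rightarrow> 'v + 'e dedge \<Rightarrow> 'w \<Rightarrow>
    ('w \<Rightarrow>\<^sub>0 'k::field)" where
  "sigma F \<phi> (Inl v) w = (if vmap \<phi> w = v then Poly_Mapping.single w 1 else 0)"
| "sigma F \<phi> (Inr (Edge e)) w =
     (if \<exists>f\<in>out_arcs F w. amap \<phi> f = e
      then Poly_Mapping.single (head F (THE f. f \<in> out_arcs F w \<and> amap \<phi> f = e)) 1 else 0)"
| "sigma F \<phi> (Inr (Ghost e)) w =
     (if \<exists>f\<in>in_arcs F w. amap \<phi> f = e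
      then Poly_Mapping.single (tail F (THE f. f \<in> in_arcs F w \<and> amap \<phi> f = e)) 1 else 0)"

definition End_op :: "('w \<Rightarrow>\<^sub>0 'k::field) set \<Rightarrow> (('w \<Rightarrow>\<^sub>0 'k) \<Rightarrow> ('w \<Rightarrow>\<^sub>0 'k), 'k) kalgebra" where
  "End_op V = \<lparr>
     kcarrier = {h \<in> V \<rightarrow>\<^sub>E V. (\<forall>x\<in>V. \<forall>y\<in>V. h (x + y) = h x + h y) \<and>
                               (\<forall>c. \<forall>x\<in>V. h (scale c x) = scale c (h x))},
     kadd = (\<lambda>g h. \<lambda>x\<in>V. g x + h x),
     kmult = (\<lambda>g h. \<lambda>x\<in>V. h (g x)),
     ksmult = (\<lambda>c g. \<lambda>x\<in>V. scale c (g x)) \<rparr>"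

definition is_pi :: "('v,'e) bisep_graph \<Rightarrow> ('w,'f) pre_digraph \<Rightarrow> ('w,'f,'v,'e) graph_map \<Rightarrow>
    (('v,'e,'k::field) Lfree set \<Rightarrow> ('w \<Rightarrow>\<^sub>0 'k) \<Rightarrow> ('w \<Rightarrow>\<^sub>0 'k)) \<Rightarrow> bool" where
  "is_pi B F \<phi> \<pi> \<longleftrightarrow> \<pi> \<in> extensional (kcarrier (Lalg B)) \<and>
     kalgebra_hom (Lalg B) (End_op (Vspace F)) \<pi> \<and>
     (\<forall>g\<in>L_gens B. \<pi> (Lgen B g) = restrict (lin_ext (sigma F \<phi> g)) (Vspace F))"

text \<open>Theorem \<open>is_pi_ex1\<close> below: there is exactly one such \<open>\<pi>\<close>.\<close>

definition pi_hom :: "('v,'e) bisep_graph \<Rightarrow> ('w,'f) pre_digraph \<Rightarrow> ('w,'f,'v,'e) graph_map \<Rightarrow>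
    ('v,'e,'k::field) Lfree set \<Rightarrow> ('w \<Rightarrow>\<^sub>0 'k) \<Rightarrow> ('w \<Rightarrow>\<^sub>0 'k)" where
  "pi_hom B F \<phi> = (THE \<pi>. is_pi B F \<phi> \<pi>)"

definition Vaction :: "('v,'e) bisep_graph \<Rightarrow> ('w,'f) pre_digraph \<Rightarrow> ('w,'f,'v,'e) graph_map \<Rightarrow>
    ('w \<Rightarrow>\<^sub>0 'k::field) \<Rightarrow> ('v,'e,'k) Lfree set \<Rightarrow> ('w \<Rightarrow>\<^sub>0 'k)" where
  "Vaction B F \<phi> x a = pi_hom B F \<phi> a x"

text \<open>For modules on an additive subgroup \<open>M\<close> of a type, acted on from the right by the carrier \<open>A\<close>
  of an algebra.  Stability under scalars is not imposed on submodules; for the modules above it is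
  automatic, as every \<open>x\<close> equals \<open>x.u\<close> for a sum \<open>u\<close> of vertices and \<open>c x = x.(c u)\<close>.\<close>

definition right_submodule :: "'a set \<Rightarrow> ('m::ab_group_add \<Rightarrow> 'a \<Rightarrow> 'm) \<Rightarrow> 'm set \<Rightarrow> 'm set \<Rightarrow> bool" where
  "right_submodule A act M N \<longleftrightarrow> N \<subseteq> M \<and> 0 \<in> N \<and> (\<forall>x\<in>N. \<forall>y\<in>N. x - y \<in> N) \<and>
     (\<forall>x\<in>N. \<forall>a\<in>A. act x a \<in> N)"

definition indecomposable_right_module ::
  "'a set \<Rightarrow> ('m::ab_group_add \<Rightarrow> 'a \<Rightarrow> 'm) \<Rightarrow> 'm set \<Rightarrow> bool" where
  "indecomposable_right_module A act M \<longleftrightarrow> M \<noteq> {0} \<and>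
     \<not> (\<exists>N1 N2. right_submodule A act M N1 \<and> right_submodule A act M N2 \<and>
          N1 \<noteq> {0} \<and> N2 \<noteq> {0} \<and> N1 \<inter> N2 = {0} \<and> {x + y | x y. x \<in> N1 \<and> y \<in> N2} = M)"


section \<open>Coverings of arbitrary type; \<open>(T, \<zeta>)\<close> is an object of its component\<close>

lemma double_simps:
  "verts (double_graph G) = verts G"
  "Edge e \<in> arcs (double_graph G) \<longleftrightarrow> e \<in> arcs G" "Ghost e \<in> arcs (double_graph G) \<longleftrightarrow> e \<in> arcs G"
  "tail (double_graph G) (Edge e) = tail G e" "head (double_graph G) (Edge e) = head G e"
  "tail (double_graph G) (Ghost e) = head G e" "head (double_graph G) (Ghost e) = tail G e"
  by (auto simp: double_graph_def)

lemma awalk_image_unique: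
  assumes cov: "covering E G \<psi>"
  shows "pre_digraph.cas (double_graph G) u p v \<Longrightarrow> pre_digraph.cas (double_graph G) u q v' \<Longrightarrow>
    set p \<subseteq> arcs (double_graph G) \<Longrightarrow> set q \<subseteq> arcs (double_graph G) \<Longrightarrow>
    map (map_dedge (amap \<psi>)) p = map (map_dedge (amap \<psi>)) q \<Longrightarrow> v = v'"
proof (induction p arbitrary: u q)
  case Nil
  then show ?case by (simp add: pre_digraph.cas.simps)
next
  case (Cons x p)
  then obtain y q' where q: "q = y # q'" by (cases q) auto
  have wf: "wf_digraph G" using cov by (simp add: covering_def connected_graph_def)
  have xy: "x \<in> arcs (double_graph G)" "y \<in> arcs (double_graph G)"
    "tail (double_graph G) x = u" "tail (double_graph G) y = u"
    "map_dedge (amap \<psi>) x = map_dedge (amap \<psi>) y"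
    using Cons.prems q by (auto simp: pre_digraph.cas.simps)
  have "x = y"
  proof (cases x)
    case (Edge e)
    then obtain e' where y: "y = Edge e'" "amap \<psi> e = amap \<psi> e'" using xy(5) by (cases y) auto
    have "u \<in> verts G" "e \<in> out_arcs G u" "e' \<in> out_arcs G u"
      using xy Edge y wf wf_digraph.tail_in_verts[OF wf] by (auto simp: double_simps)
    then have "inj_on (amap \<psi>) (out_arcs G u)" "e \<in> out_arcs G u" "e' \<in> out_arcs G u"
      using cov by (simp_all add: covering_def bij_betw_def)
    then have "e = e'" using y(2) by (meson inj_onD)
    then show ?thesis using Edge y by simp
  next
    case (Ghost e)
    then obtain e' where y: "y = Ghost e'" "amap \<psi> e = amap \<psi> e'" using xy(5) by (cases y) auto
    have "u \<in> verts G" "e \<in> in_arcs G u" "e' \<in> in_arcs G u"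
      using xy Ghost y wf wf_digraph.head_in_verts[OF wf] by (auto simp: double_simps)
    then have "inj_on (amap \<psi>) (in_arcs G u)" "e \<in> in_arcs G u" "e' \<in> in_arcs G u"
      using cov by (simp_all add: covering_def bij_betw_def)
    then have "e = e'" using y(2) by (meson inj_onD)
    then show ?thesis using Ghost y by simp
  qed
  then show ?case using Cons.prems q by (intro Cons.IH[of "head (double_graph G) x" q'])
      (auto simp: pre_digraph.cas.simps)
qed

lemma covering_transport:
  assumes cov: "covering E G \<psi>" and c: "inj_on c (verts G)" and d: "inj_on d (arcs G)"
  defines "ci \<equiv> inv_into (verts G) c" and "di \<equiv> inv_into (arcs G) d"
  defines "H \<equiv> \<lparr> verts = c ` verts G, arcs = d ` arcs G, tail = c \<circ> tail G \<circ> di, head = c \<circ> head G \<circ> di \<rparr>"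
  shows "covering E H \<lparr> vmap = vmap \<psi> \<circ> ci, amap = amap \<psi> \<circ> di \<rparr>"
    and "graph_hom H G \<lparr> vmap = ci, amap = di \<rparr>"
proof -
  have G: "wf_digraph G" "verts G \<noteq> {}" and hom: "graph_hom G E \<psi>"
    and walk: "\<And>u v. u \<in> verts G \<Longrightarrow> v \<in> verts G \<Longrightarrow> \<exists>p. pre_digraph.awalk (double_graph G) u p v"
    using cov by (auto simp: covering_def connected_graph_def)
  note tv = wf_digraph.tail_in_verts[OF G(1)] and hv = wf_digraph.head_in_verts[OF G(1)]
  have ci: "\<And>v. v \<in> verts G \<Longrightarrow> ci (c v) = v" and di: "\<And>e. e \<in> arcs G \<Longrightarrow> di (d e) = e"
    using c d by (auto simp: ci_def di_def)
  have H: "verts H = c ` verts G" "arcs H = d ` arcs G"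
    "\<And>e. e \<in> arcs G \<Longrightarrow> tail H (d e) = c (tail G e)" "\<And>e. e \<in> arcs G \<Longrightarrow> head H (d e) = c (head G e)"
    by (auto simp: H_def di)
  have cas: "pre_digraph.cas (double_graph H) (c u) (map (map_dedge d) p) (c v) \<and>
      set (map (map_dedge d) p) \<subseteq> arcs (double_graph H)"
    if "pre_digraph.cas (double_graph G) u p v" "set p \<subseteq> arcs (double_graph G)" for u v p
    using that
  proof (induction p arbitrary: u)
    case (Cons x p)
    then show ?case by (cases x) (auto simp: pre_digraph.cas.simps double_simps H)
  qed (simp add: pre_digraph.cas.simps)
  have conn: "connected_graph H"
    unfolding connected_graph_def
  proof (intro conjI ballI)
    show "wf_digraph H"
    proof
      fix e assume "e \<in> arcs H"
      then obtain e' where "e = d e'" "e' \<in> arcs G" unfolding H(2) by blast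
      then show "tail H e \<in> verts H" "head H e \<in> verts H"
        unfolding H(1) by (simp_all add: H(3,4) tv hv)
    qed
    show "verts H \<noteq> {}" using G by (simp add: H)
    fix u v assume "u \<in> verts H" "v \<in> verts H"
    then obtain u' v' where uv: "u = c u'" "v = c v'" "u' \<in> verts G" "v' \<in> verts G" by (auto simp: H)
    obtain p where "pre_digraph.awalk (double_graph G) u' p v'" using walk[OF uv(3,4)] by blast
    then show "\<exists>p. pre_digraph.awalk (double_graph H) u p v"
      using cas[of u' p v'] uv
      by (intro exI[of _ "map (map_dedge d) p"]) (auto simp: pre_digraph.awalk_def double_simps H)
  qed
  have outH: "out_arcs H (c v) = d ` out_arcs G v" "in_arcs H (c v) = d ` in_arcs G v"
    if v: "v \<in> verts G" for v
  proof -
    have "tail H (d e) = c v \<longleftrightarrow> tail G e = v" "head H (d e) = c v \<longleftrightarrow> head G e = v"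
      if "e \<in> arcs G" for e
      using that v tv hv by (simp_all add: H(3,4) inj_on_eq_iff[OF c])
    then show "out_arcs H (c v) = d ` out_arcs G v" "in_arcs H (c v) = d ` in_arcs G v"
      unfolding out_arcs_def in_arcs_def H(2) by blast+
  qed
  show "graph_hom H G \<lparr> vmap = ci, amap = di \<rparr>"
    unfolding graph_hom_def H(1,2) by (auto simp: H(3,4) ci di tv hv)
  have hom': "graph_hom H E \<lparr> vmap = vmap \<psi> \<circ> ci, amap = amap \<psi> \<circ> di \<rparr>"
    using hom unfolding graph_hom_def H(1,2) by (auto simp: H(3,4) ci di tv hv)
  have bij: "bij_betw (amap \<psi> \<circ> di) (d ` S) Q" if "bij_betw (amap \<psi>) S Q" "S \<subseteq> arcs G" for S Q
  proof -
    have "bij_betw di (d ` S) S"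
      using that(2) di by (intro bij_betw_byWitness[where f' = d]) auto
    then show ?thesis using that(1) by (rule bij_betw_trans)
  qed
  show "covering E H \<lparr> vmap = vmap \<psi> \<circ> ci, amap = amap \<psi> \<circ> di \<rparr>"
    unfolding covering_def
  proof (intro conjI ballI conn hom')
    fix v assume "v \<in> verts H"
    then obtain v' where v: "v = c v'" "v' \<in> verts G" by (auto simp: H)
    have b: "bij_betw (amap \<psi>) (out_arcs G v') (out_arcs E (vmap \<psi> v'))"
      "bij_betw (amap \<psi>) (in_arcs G v') (in_arcs E (vmap \<psi> v'))"
      using cov v by (auto simp: covering_def)
    have sub: "out_arcs G v' \<subseteq> arcs G" "in_arcs G v' \<subseteq> arcs G" by auto
    have vm: "(vmap \<psi> \<circ> ci) (c v') = vmap \<psi> v'"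
      using v ci by simp
    show "bij_betw (amap \<lparr>vmap = vmap \<psi> \<circ> ci, amap = amap \<psi> \<circ> di\<rparr>) (out_arcs H v)
        (out_arcs E (vmap \<lparr>vmap = vmap \<psi> \<circ> ci, amap = amap \<psi> \<circ> di\<rparr> v))"
      unfolding v(1) outH(1)[OF v(2)] graph_map.simps vm by (rule bij[OF b(1) sub(1)])
    show "bij_betw (amap \<lparr>vmap = vmap \<psi> \<circ> ci, amap = amap \<psi> \<circ> di\<rparr>) (in_arcs H v)
        (in_arcs E (vmap \<lparr>vmap = vmap \<psi> \<circ> ci, amap = amap \<psi> \<circ> di\<rparr> v))"
      unfolding v(1) outH(2)[OF v(2)] graph_map.simps vm by (rule bij[OF b(2) sub(2)])
  qed
qed

lemma graph_hom_comp: "graph_hom T H \<alpha> \<Longrightarrow> graph_hom H G \<beta> \<Longrightarrow> graph_hom T G (comp_map \<beta> \<alpha>)"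
proof -
  assume a: "graph_hom T H \<alpha>" "graph_hom H G \<beta>"
  have v: "vmap \<alpha> x \<in> verts H" if "x \<in> verts T" for x
    using a(1) that unfolding graph_hom_def by blast
  have v': "vmap \<beta> x \<in> verts G" if "x \<in> verts H" for x
    using a(2) that unfolding graph_hom_def by blast
  have e: "amap \<alpha> x \<in> arcs H" "tail H (amap \<alpha> x) = vmap \<alpha> (tail T x)"
      "head H (amap \<alpha> x) = vmap \<alpha> (head T x)" if "x \<in> arcs T" for x
    using a(1) that unfolding graph_hom_def by blast+
  have e': "amap \<beta> x \<in> arcs G" "tail G (amap \<beta> x) = vmap \<beta> (tail H x)"
      "head G (amap \<beta> x) = vmap \<beta> (head H x)" if "x \<in> arcs H" for x
    using a(2) that unfolding graph_hom_def by blast+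
  show ?thesis by (simp add: graph_hom_def comp_map_def v v' e e')
qed

theorem universal_covering_morphism:
  assumes univ: "universal_covering E T \<tau>" and cov: "covering E G \<psi>"
  shows "\<exists>\<alpha>. morphism_over T \<tau> G \<psi> \<alpha>"
proof -
  have conn: "connected_graph G" using cov by (simp add: covering_def)
  then have wf: "wf_digraph G" and ne: "verts G \<noteq> {}" and
    walk: "\<forall>u\<in>verts G. \<forall>w\<in>verts G. \<exists>p. pre_digraph.awalk (double_graph G) u p w"
    by (simp_all add: connected_graph_def)
  obtain g0 where g0: "g0 \<in> verts G" using ne by blast
  have "\<exists>p. \<forall>w\<in>verts G. pre_digraph.awalk (double_graph G) g0 (p w) w"
    using walk[rule_format, OF g0] by (intro bchoice) blast
  then obtain p where p: "\<And>w. w \<in> verts G \<Longrightarrow> pre_digraph.awalk (double_graph G) g0 (p w) w"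
    by blast
  define c where "c w = map (map_dedge (amap \<psi>)) (p w)" for w
  define d where "d f = (c (tail G f), amap \<psi> f)" for f
  have c: "inj_on c (verts G)"
  proof (rule inj_onI)
    fix w w' assume w: "w \<in> verts G" "w' \<in> verts G" "c w = c w'"
    show "w = w'"
      using p[OF w(1)] p[OF w(2)] w(3) unfolding c_def pre_digraph.awalk_def
      by (elim conjE) (rule awalk_image_unique[OF cov])
  qed
  have d: "inj_on d (arcs G)"
  proof (rule inj_onI)
    fix f f' assume f: "f \<in> arcs G" "f' \<in> arcs G" and eq: "d f = d f'"
    note tv = wf_digraph.tail_in_verts[OF wf]
    have "c (tail G f) = c (tail G f')" and am: "amap \<psi> f = amap \<psi> f'"
      using eq by (simp_all add: d_def)
    then have t: "tail G f = tail G f'" using inj_onD[OF c] tv f by blast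
    have "inj_on (amap \<psi>) (out_arcs G (tail G f))"
      using cov tv[OF f(1)] unfolding covering_def bij_betw_def by blast
    then show "f = f'" by (rule inj_onD) (use am f t in \<open>simp_all\<close>)
  qed
  let ?ci = "inv_into (verts G) c" and ?di = "inv_into (arcs G) d"
  let ?H = "\<lparr> verts = c ` verts G, arcs = d ` arcs G, tail = c \<circ> tail G \<circ> ?di, head = c \<circ> head G \<circ> ?di \<rparr>"
  let ?\<psi> = "\<lparr> vmap = vmap \<psi> \<circ> ?ci, amap = amap \<psi> \<circ> ?di \<rparr>"
  note tr = covering_transport[OF cov c d]
  have "\<exists>\<alpha>. morphism_over T \<tau> ?H ?\<psi> \<alpha>"
    by (rule conjunct2[OF univ[unfolded universal_covering_def], rule_format, OF tr(1)])
  then obtain \<alpha> where \<alpha>: "morphism_over T \<tau> ?H ?\<psi> \<alpha>" ..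
  have "morphism_over T \<tau> G \<psi> (comp_map \<lparr> vmap = ?ci, amap = ?di \<rparr> \<alpha>)"
    unfolding morphism_over_def
  proof (intro conjI graph_hom_comp)
    show "graph_hom T ?H \<alpha>" using \<alpha> by (simp add: morphism_over_def)
    show "graph_hom ?H G \<lparr> vmap = ?ci, amap = ?di \<rparr>" by (rule tr(2))
  qed (use \<alpha> in \<open>simp_all add: morphism_over_def comp_map_def\<close>)
  then show ?thesis by blast
qed

lemma representation_graph_covering:
  assumes rg: "representation_graph B F \<phi>" and cov: "covering F T \<tau>"
  shows "representation_graph B T (comp_map \<phi> \<tau>)"
proof -
  have hom: "graph_hom F (graph_of B) \<phi>" "graph_hom T F \<tau>" and T: "connected_graph T"
    using rg cov by (auto simp: representation_graph_def covering_def)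
  have ex1: "\<exists>!f. f \<in> S \<and> amap (comp_map \<phi> \<tau>) f \<in> X"
    if b: "bij_betw (amap \<tau>) S S'" and u: "\<exists>!f. f \<in> S' \<and> amap \<phi> f \<in> X" for S S' X
  proof -
    from u obtain f where f': "f \<in> S' \<and> amap \<phi> f \<in> X" "\<forall>g. g \<in> S' \<and> amap \<phi> g \<in> X \<longrightarrow> g = f"
      by (rule ex1E)
    have f: "f \<in> S'" "amap \<phi> f \<in> X" by (rule conjunct1[OF f'(1)], rule conjunct2[OF f'(1)])
    have uniq: "g = f" if "g \<in> S'" "amap \<phi> g \<in> X" for g
      using that by (intro f'(2)[rule_format] conjI)
    obtain t where t: "t \<in> S" "amap \<tau> t = f" using b f(1) by (auto simp: bij_betw_def)
    show ?thesis
    proof (rule ex1I[of _ t])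
      show "t \<in> S \<and> amap (comp_map \<phi> \<tau>) t \<in> X" using t f by (simp add: comp_map_def)
      fix u assume uS: "u \<in> S \<and> amap (comp_map \<phi> \<tau>) u \<in> X"
      then have "amap \<tau> u = f" using b by (intro uniq) (auto simp: comp_map_def bij_betw_def)
      then show "u = t" using inj_onD[OF bij_betw_imp_inj_on[OF b], of u t] t uS by simp
    qed
  qed
  have v: "vmap \<tau> w \<in> verts F" if "w \<in> verts T" for w
    using hom(2) that by (auto simp: graph_hom_def)
  show ?thesis unfolding representation_graph_def
  proof (intro conjI ballI T)
    show "graph_hom T (graph_of B) (comp_map \<phi> \<tau>)"
      using graph_hom_comp hom by blast
  next
    fix w X assume w: "w \<in> verts T" "X \<in> Cpart B (vmap (comp_map \<phi> \<tau>) w)"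
    show "\<exists>!f. f \<in> out_arcs T w \<and> amap (comp_map \<phi> \<tau>) f \<in> X"
    proof (rule ex1)
      show "bij_betw (amap \<tau>) (out_arcs T w) (out_arcs F (vmap \<tau> w))"
        using cov w(1) by (simp add: covering_def)
      have "\<forall>w\<in>verts F. \<forall>X\<in>Cpart B (vmap \<phi> w). \<exists>!f. f \<in> out_arcs F w \<and> amap \<phi> f \<in> X"
        using rg unfolding representation_graph_def by (elim conjE)
      moreover have "X \<in> Cpart B (vmap \<phi> (vmap \<tau> w))" using w(2) by (simp add: comp_map_def)
      ultimately show "\<exists>!f. f \<in> out_arcs F (vmap \<tau> w) \<and> amap \<phi> f \<in> X"
        by (rule bspec[OF bspec[OF _ v[OF w(1)]]])
    qed
  next
    fix w X assume w: "w \<in> verts T" "X \<in> Dpart B (vmap (comp_map \<phi> \<tau>) w)"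
    show "\<exists>!f. f \<in> in_arcs T w \<and> amap (comp_map \<phi> \<tau>) f \<in> X"
    proof (rule ex1)
      show "bij_betw (amap \<tau>) (in_arcs T w) (in_arcs F (vmap \<tau> w))"
        using cov w(1) by (simp add: covering_def)
      have "\<forall>w\<in>verts F. \<forall>X\<in>Dpart B (vmap \<phi> w). \<exists>!f. f \<in> in_arcs F w \<and> amap \<phi> f \<in> X"
        using rg unfolding representation_graph_def by (elim conjE)
      moreover have "X \<in> Dpart B (vmap \<phi> (vmap \<tau> w))" using w(2) by (simp add: comp_map_def)
      ultimately show "\<exists>!f. f \<in> in_arcs F (vmap \<tau> w) \<and> amap \<phi> f \<in> X"
        by (rule bspec[OF bspec[OF _ v[OF w(1)]]])
    qed
  qed
qed

lemma RG_component_subset: "\<C> \<in> RG_components B \<Longrightarrow> \<C> \<subseteq> RG B"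
proof -
  have "P \<in> RG B \<longrightarrow> Q \<in> RG B" if "(P, Q) \<in> (RG_morphisms B \<union> (RG_morphisms B)\<inverse>)\<^sup>*" for P Q
    using that by (induction rule: rtrancl_induct) (auto simp: RG_morphisms_def)
  then show "\<C> \<in> RG_components B \<Longrightarrow> \<C> \<subseteq> RG B"
    unfolding RG_components_def quotient_def by blast
qed

lemma is_T_zeta_representation_graph:
  assumes "\<C> \<in> RG_components B" "is_T_zeta \<C> T \<zeta>"
  shows "representation_graph B T \<zeta>"
  using assms RG_component_subset[OF assms(1)] representation_graph_covering
  unfolding is_T_zeta_def universal_covering_def RG_def by blast

theorem is_T_zeta_in_component:
  fixes \<C> :: "('w,'f,'v,'e) graph_over set" and T :: "('w,'f) pre_digraph"
  assumes C: "\<C> \<in> RG_components B" and T: "is_T_zeta \<C> T \<zeta>"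
  shows "(T, \<zeta>) \<in> \<C>"
proof -
  obtain F \<phi> \<tau> where F: "(F, \<phi>) \<in> \<C>" "universal_covering F T \<tau>" "\<zeta> = comp_map \<phi> \<tau>"
    using T by (auto simp: is_T_zeta_def)
  have "(F, \<phi>) \<in> RG B" using RG_component_subset[OF C] F(1) by blast
  moreover have "(T, \<zeta>) \<in> RG B" using is_T_zeta_representation_graph[OF assms] by (simp add: RG_def)
  moreover have "morphism_over T \<zeta> F \<phi> \<tau>"
    using F by (auto simp: morphism_over_def universal_covering_def covering_def)
  ultimately have "((F, \<phi>), (T, \<zeta>)) \<in> (RG_morphisms B \<union> (RG_morphisms B)\<inverse>)"
    by (auto simp: RG_morphisms_def)
  then show ?thesis using C F(1) unfolding RG_components_def quotient_def
    by (auto intro: rtrancl_into_rtrancl)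
qed


section \<open>Existence and uniqueness of \<open>\<pi>\<close>\<close>

lemma lookup_scale [simp]: "Poly_Mapping.lookup (scale c x) k = c * Poly_Mapping.lookup x k"
  unfolding scale_def by transfer (auto simp: when_def)

lemma scale_add: "scale c (x + y) = scale c x + scale c y"
  by (rule poly_mapping_eqI) (simp add: lookup_add algebra_simps)

lemma scale_add_left: "scale (c + d) x = scale c x + scale d x"
  by (rule poly_mapping_eqI) (simp add: lookup_add algebra_simps)

lemma scale_scale: "scale c (scale d x) = scale (c * d) x"
  by (rule poly_mapping_eqI) (simp add: algebra_simps)

lemma scale_zero [simp]: "scale c 0 = 0" "scale 0 x = 0" "scale 1 x = x"
  by (rule poly_mapping_eqI; simp)+

lemma scale_uminus: "scale (-1) x = - x"
  by (rule poly_mapping_eqI) simp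

lemma scale_single [simp]: "scale c (Poly_Mapping.single k d) = Poly_Mapping.single k (c * d)"
  by (rule poly_mapping_eqI) (simp add: lookup_single when_def)

lemma scale_sum: "scale c (sum f A) = (\<Sum>a\<in>A. scale c (f a))"
  by (induction A rule: infinite_finite_induct) (auto simp: scale_add)

lemma scale_conv_mult: "scale c x = Poly_Mapping.single 0 c * x"
  unfolding scale_def by (rule mult_map_scale_conv_mult)

lemma scale_mult_left: "scale c (x * y) = scale c x * y"
  for x y :: "'x free_monoid \<Rightarrow>\<^sub>0 'k::field"
  by (simp add: scale_conv_mult mult.assoc)

lemma single_zero_commute: "Poly_Mapping.single 0 c * x = x * Poly_Mapping.single 0 c"
  for x :: "'x free_monoid \<Rightarrow>\<^sub>0 'k::field"
proof (induction x rule: update_induct)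
  case const
  show ?case by simp
next
  case (update f a b)
  have "Poly_Mapping.update a b f = f + Poly_Mapping.single a b"
    using update by (intro poly_mapping_eqI)
      (auto simp: lookup_update lookup_add lookup_single when_def in_keys_iff)
  then show ?case using update by (simp add: distrib_left distrib_right mult_single mult.commute)
qed

lemma scale_mult_right: "scale c (x * y) = x * scale c y"
  for x y :: "'x free_monoid \<Rightarrow>\<^sub>0 'k::field"
  by (metis mult.assoc scale_conv_mult single_zero_commute)

lemma keys_scale: "Poly_Mapping.keys (scale c x) \<subseteq> Poly_Mapping.keys x"
  by (auto simp: in_keys_iff)

lemma lin_ext_superset:
  assumes "finite A" "Poly_Mapping.keys x \<subseteq> A"
  shows "lin_ext b x = (\<Sum>w\<in>A. scale (Poly_Mapping.lookup x w) (b w))"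
  unfolding lin_ext_def
  by (rule sum.mono_neutral_left) (use assms in \<open>auto simp: in_keys_iff\<close>)

lemma lin_ext_add: "lin_ext b (x + y) = lin_ext b x + lin_ext b y"
proof -
  let ?A = "Poly_Mapping.keys x \<union> Poly_Mapping.keys y"
  have "lin_ext b (x + y) = (\<Sum>w\<in>?A. scale (Poly_Mapping.lookup (x + y) w) (b w))"
    using keys_add[of x y] by (intro lin_ext_superset) auto
  moreover have "lin_ext b x = (\<Sum>w\<in>?A. scale (Poly_Mapping.lookup x w) (b w))"
    "lin_ext b y = (\<Sum>w\<in>?A. scale (Poly_Mapping.lookup y w) (b w))"
    by (rule lin_ext_superset; auto)+
  ultimately show ?thesis by (simp add: lookup_add scale_add_left sum.distrib)
qed

lemma lin_ext_scale: "lin_ext b (scale c x) = scale c (lin_ext b x)"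
proof -
  have "lin_ext b (scale c x) =
      (\<Sum>w\<in>Poly_Mapping.keys x. scale (Poly_Mapping.lookup (scale c x) w) (b w))"
    by (rule lin_ext_superset) (simp_all add: keys_scale)
  then show ?thesis unfolding lin_ext_def scale_sum by (simp add: scale_scale)
qed

lemma lin_ext_zero [simp]: "lin_ext b 0 = 0"
  by (simp add: lin_ext_def)

lemma lin_ext_uminus: "lin_ext b (- x) = - lin_ext b x"
  by (metis lin_ext_scale scale_uminus)

lemma lin_ext_diff: "lin_ext b (x - y) = lin_ext b x - lin_ext b y"
  by (metis lin_ext_add lin_ext_uminus add_uminus_conv_diff)

lemma lin_ext_sum: "lin_ext b (sum f A) = (\<Sum>a\<in>A. lin_ext b (f a))"
  by (induction A rule: infinite_finite_induct) (auto simp: lin_ext_add)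

lemma lin_ext_single [simp]: "lin_ext b (Poly_Mapping.single w c) = scale c (b w)"
  by (auto simp: lin_ext_def)

lemma sum_singles: "(\<Sum>w\<in>Poly_Mapping.keys x. scale (Poly_Mapping.lookup x w) (Poly_Mapping.single w 1)) = x"
  by (rule poly_mapping_eqI)
     (auto simp: lookup_sum lookup_single when_def in_keys_iff sum.delta')

lemma Vspace_simps:
  "0 \<in> Vspace F" "x \<in> Vspace F \<Longrightarrow> y \<in> Vspace F \<Longrightarrow> x + y \<in> Vspace F"
  "x \<in> Vspace F \<Longrightarrow> scale c x \<in> Vspace F"
  "w \<in> verts F \<Longrightarrow> Poly_Mapping.single w c \<in> Vspace F"
  using keys_add[of x y] keys_scale[of c x] by (auto simp: Vspace_def)

lemma Vspace_sum: "(\<And>a. a \<in> A \<Longrightarrow> f a \<in> Vspace F) \<Longrightarrow> sum f A \<in> Vspace F"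
  by (induction A rule: infinite_finite_induct) (auto simp: Vspace_simps)

lemma lin_ext_Vspace:
  "(\<And>w. w \<in> verts F \<Longrightarrow> b w \<in> Vspace G) \<Longrightarrow> x \<in> Vspace F \<Longrightarrow> lin_ext b x \<in> Vspace G"
  unfolding lin_ext_def by (intro Vspace_sum Vspace_simps) (auto simp: Vspace_def)

lemma free_algebra_simps:
  "0 \<in> free_algebra X" "x \<in> free_algebra X \<Longrightarrow> y \<in> free_algebra X \<Longrightarrow> x + y \<in> free_algebra X"
  "x \<in> free_algebra X \<Longrightarrow> scale c x \<in> free_algebra X"
  "x \<in> free_algebra X \<Longrightarrow> y \<in> free_algebra X \<Longrightarrow> x * y \<in> free_algebra X"
  "g \<in> X \<Longrightarrow> gen g \<in> free_algebra X"
proof -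
  show "x \<in> free_algebra X \<Longrightarrow> y \<in> free_algebra X \<Longrightarrow> x + y \<in> free_algebra X"
    using keys_add[of x y] by (fastforce simp: free_algebra_def)
  show "x \<in> free_algebra X \<Longrightarrow> scale c x \<in> free_algebra X"
    using keys_scale[of c x] by (fastforce simp: free_algebra_def)
  show "x \<in> free_algebra X \<Longrightarrow> y \<in> free_algebra X \<Longrightarrow> x * y \<in> free_algebra X"
    using keys_mult[of x y] by (fastforce simp: free_algebra_def plus_free_monoid_def)
qed (auto simp: free_algebra_def gen_def)

lemma ideal_gen_uminus: "a \<in> ideal_gen X R \<Longrightarrow> - a \<in> ideal_gen X R"
  by (metis ideal_gen.scale scale_uminus)

lemma ideal_gen_diff: "a \<in> ideal_gen X R \<Longrightarrow> b \<in> ideal_gen X R \<Longrightarrow> a - b \<in> ideal_gen X R"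
  by (metis ideal_gen.add ideal_gen_uminus add_uminus_conv_diff)

lemma coset_eq_iff: "coset X R a = coset X R b \<longleftrightarrow> a - b \<in> ideal_gen X R"
proof
  assume "coset X R a = coset X R b"
  moreover have "a \<in> coset X R a" by (simp add: coset_def ideal_gen.zero)
  ultimately show "a - b \<in> ideal_gen X R" by (simp add: coset_def)
next
  assume ab: "a - b \<in> ideal_gen X R"
  have "c - a \<in> ideal_gen X R \<longleftrightarrow> c - b \<in> ideal_gen X R" for c
    using ideal_gen.add[OF _ ab, of "c - a"] ideal_gen_diff[OF _ ab, of "c - b"] by auto
  then show "coset X R a = coset X R b" by (simp add: coset_def)
qed

lemma ideal_gen_free: "R \<subseteq> free_algebra X \<Longrightarrow> a \<in> ideal_gen X R \<Longrightarrow> a \<in> free_algebra X"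
  by (rotate_tac, induction rule: ideal_gen.induct) (auto simp: free_algebra_simps)

lemma coset_free:
  assumes "R \<subseteq> free_algebra X" "a \<in> free_algebra X" "u \<in> coset X R a"
  shows "u \<in> free_algebra X"
proof -
  have "(u - a) + a \<in> free_algebra X"
    using assms ideal_gen_free by (intro free_algebra_simps) (auto simp: coset_def)
  then show ?thesis by simp
qed

lemma UN_const: "A \<noteq> {} \<Longrightarrow> (\<And>u. u \<in> A \<Longrightarrow> f u = c) \<Longrightarrow> (\<Union>u\<in>A. f u) = c"
  by auto

lemma coset_ne: "coset X R a \<noteq> {}"
  by (auto simp: coset_def intro!: exI[of _ a] ideal_gen.zero)

lemma presented_ops:
  assumes R: "R \<subseteq> free_algebra X" and a: "a \<in> free_algebra X" and b: "b \<in> free_algebra X"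
  shows "kadd (presented_algebra X R) (coset X R a) (coset X R b) = coset X R (a + b)"
    and "kmult (presented_algebra X R) (coset X R a) (coset X R b) = coset X R (a * b)"
    and "ksmult (presented_algebra X R) c (coset X R a) = coset X R (scale c a)"
proof -
  show "kadd (presented_algebra X R) (coset X R a) (coset X R b) = coset X R (a + b)"
    unfolding presented_algebra_def kalgebra.simps
  proof (intro UN_const coset_ne)
    fix u v assume "u \<in> coset X R a" "v \<in> coset X R b"
    then have "(u - a) + (v - b) \<in> ideal_gen X R" by (intro ideal_gen.add) (auto simp: coset_def)
    then show "coset X R (u + v) = coset X R (a + b)"
      unfolding coset_eq_iff by (simp add: algebra_simps)
  qed
  show "kmult (presented_algebra X R) (coset X R a) (coset X R b) = coset X R (a * b)"
    unfolding presented_algebra_def kalgebra.simps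
  proof (intro UN_const coset_ne)
    fix u v assume u: "u \<in> coset X R a" and v: "v \<in> coset X R b"
    have "(u - a) * v + a * (v - b) \<in> ideal_gen X R"
      using u v coset_free[OF R b v] a
      by (intro ideal_gen.add ideal_gen.left ideal_gen.right) (auto simp: coset_def)
    then show "coset X R (u * v) = coset X R (a * b)"
      unfolding coset_eq_iff by (simp add: algebra_simps)
  qed
  show "ksmult (presented_algebra X R) c (coset X R a) = coset X R (scale c a)"
    unfolding presented_algebra_def kalgebra.simps
  proof (intro UN_const coset_ne)
    fix u assume "u \<in> coset X R a"
    then have "scale c (u - a) \<in> ideal_gen X R" by (intro ideal_gen.scale) (auto simp: coset_def)
    moreover have "scale c (u - a) = scale c u - scale c a"
      by (rule poly_mapping_eqI) (simp add: lookup_minus algebra_simps)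
    ultimately show "coset X R (scale c u) = coset X R (scale c a)"
      unfolding coset_eq_iff by simp
  qed
qed

lemma poly_single_add_induct:
  assumes "P 0" "\<And>w c. P (Poly_Mapping.single w c)" "\<And>x y. P x \<Longrightarrow> P y \<Longrightarrow> P (x + y)"
  shows "P (x :: 'a \<Rightarrow>\<^sub>0 'k::field)"
proof (induction x rule: update_induct)
  case const
  show ?case by fact
next
  case (update f a b)
  have "Poly_Mapping.update a b f = f + Poly_Mapping.single a b"
    using update by (intro poly_mapping_eqI)
      (auto simp: lookup_update lookup_add lookup_single when_def in_keys_iff)
  then show ?case using assms update by simp
qed

fun wact :: "('g \<Rightarrow> 'w \<Rightarrow> ('w \<Rightarrow>\<^sub>0 'k::field)) \<Rightarrow> 'g list \<Rightarrow> ('w \<Rightarrow>\<^sub>0 'k) \<Rightarrow> ('w \<Rightarrow>\<^sub>0 'k)" where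
  "wact b [] x = x"
| "wact b (g # gs) x = wact b gs (lin_ext (b g) x)"

lemma wact_append: "wact b (us @ vs) x = wact b vs (wact b us x)"
  by (induction us arbitrary: x) auto

lemma wact_add: "wact b us (x + y) = wact b us x + wact b us y"
  by (induction us arbitrary: x y) (auto simp: lin_ext_add)

lemma wact_scale: "wact b us (scale c x) = scale c (wact b us x)"
  by (induction us arbitrary: x) (auto simp: lin_ext_scale)

definition rho :: "('g \<Rightarrow> 'w \<Rightarrow> ('w \<Rightarrow>\<^sub>0 'k::field)) \<Rightarrow> ('g free_monoid \<Rightarrow>\<^sub>0 'k) \<Rightarrow> ('w \<Rightarrow>\<^sub>0 'k) \<Rightarrow> ('w \<Rightarrow>\<^sub>0 'k)"
  where "rho b a x = lin_ext (\<lambda>w. wact b (letters w) x) a"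

lemma rho_add_left: "rho b (a + a') x = rho b a x + rho b a' x"
  by (simp add: rho_def lin_ext_add)

lemma rho_scale_left: "rho b (scale c a) x = scale c (rho b a x)"
  by (simp add: rho_def lin_ext_scale)

lemma rho_diff_left: "rho b (a - a') x = rho b a x - rho b a' x"
  by (simp add: rho_def lin_ext_diff)

lemma rho_sum_left: "rho b (sum f A) x = (\<Sum>a\<in>A. rho b (f a) x)"
  by (simp add: rho_def lin_ext_sum)

lemma rho_zero_left [simp]: "rho b 0 x = 0"
  by (simp add: rho_def)

lemma rho_gen [simp]: "rho b (gen g) x = lin_ext (b g) x"
  by (simp add: rho_def gen_def)

lemma rho_add_right: "rho b a (x + y) = rho b a x + rho b a y"
  unfolding rho_def lin_ext_def by (simp add: wact_add scale_add sum.distrib)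

lemma rho_scale_right: "rho b a (scale c x) = scale c (rho b a x)"
  unfolding rho_def lin_ext_def
  by (simp add: wact_scale scale_scale scale_sum mult.commute)

lemma rho_zero_right [simp]: "rho b a 0 = 0"
  using rho_scale_right[of b a 0 0] by simp

lemma rho_sum_right: "rho b a (sum f A) = (\<Sum>i\<in>A. rho b a (f i))"
  by (induction A rule: infinite_finite_induct) (auto simp: rho_add_right)

lemma rho_mult: "rho b (a * a') x = rho b a' (rho b a x)"
proof (induction a rule: poly_single_add_induct)
  case (2 w c)
  show ?case
  proof (induction a' rule: poly_single_add_induct)
    case (2 w' c')
    show ?case
      by (simp add: rho_def mult_single plus_free_monoid_def wact_append wact_scale scale_scale mult.commute)
  qed (auto simp: distrib_left rho_add_left)
qed (auto simp: distrib_right rho_add_left rho_add_right)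

lemma rho_basis:
  assumes "\<And>w. w \<in> verts F \<Longrightarrow> rho b a (Poly_Mapping.single w 1) = 0" "x \<in> Vspace F"
  shows "rho b a x = 0"
proof -
  have "rho b a x = rho b a (\<Sum>w\<in>Poly_Mapping.keys x. scale (Poly_Mapping.lookup x w) (Poly_Mapping.single w 1))"
    by (simp add: sum_singles del: scale_single)
  also have "\<dots> = 0"
    unfolding rho_sum_right rho_scale_right using assms by (intro sum.neutral) (auto simp: Vspace_def)
  finally show ?thesis .
qed

locale bisep_rep =
  fixes B :: "('v,'e) bisep_graph" and F :: "('w,'f) pre_digraph" and \<phi>
  assumes bs: "bi_separated B" and rg: "representation_graph B F \<phi>"
begin

abbreviation "E \<equiv> graph_of B"

lemma wfF: "wf_digraph F" and wfE: "wf_digraph E"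
  using bs rg by (auto simp: bi_separated_def representation_graph_def connected_graph_def)

lemma hom: "f \<in> arcs F \<Longrightarrow> amap \<phi> f \<in> arcs E" "w \<in> verts F \<Longrightarrow> vmap \<phi> w \<in> verts E"
  "f \<in> arcs F \<Longrightarrow> tail E (amap \<phi> f) = vmap \<phi> (tail F f)"
  "f \<in> arcs F \<Longrightarrow> head E (amap \<phi> f) = vmap \<phi> (head F f)"
  using rg by (auto simp: representation_graph_def graph_hom_def)

lemma rg_out: "w \<in> verts F \<Longrightarrow> X \<in> Cpart B (vmap \<phi> w) \<Longrightarrow> \<exists>!f. f \<in> out_arcs F w \<and> amap \<phi> f \<in> X"
  and rg_in: "w \<in> verts F \<Longrightarrow> Y \<in> Dpart B (vmap \<phi> w) \<Longrightarrow> \<exists>!f. f \<in> in_arcs F w \<and> amap \<phi> f \<in> Y"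
  using rg unfolding representation_graph_def by simp_all

lemma partC: "v \<in> verts E \<Longrightarrow> partition_on (out_arcs E v) (Cpart B v)"
  and partD: "v \<in> verts E \<Longrightarrow> partition_on (in_arcs E v) (Dpart B v)"
  and finC: "X \<in> Call B \<Longrightarrow> finite X"
  and finD: "Y \<in> Dall B \<Longrightarrow> finite Y"
  and card_XY: "X \<in> Call B \<Longrightarrow> Y \<in> Dall B \<Longrightarrow> card (X \<inter> Y) \<le> 1"
  using bs unfolding bi_separated_def by simp_all

lemma CallI: "X \<in> Cpart B v \<Longrightarrow> v \<in> verts E \<Longrightarrow> X \<in> Call B"
  and DallI: "Y \<in> Dpart B v \<Longrightarrow> v \<in> verts E \<Longrightarrow> Y \<in> Dall B"
  by (auto simp: Call_def Dall_def)

lemma CallE: assumes "X \<in> Call B" obtains v where "v \<in> verts E" "X \<in> Cpart B v"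
  using assms by (auto simp: Call_def)

lemma DallE: assumes "X \<in> Dall B" obtains v where "v \<in> verts E" "X \<in> Dpart B v"
  using assms by (auto simp: Dall_def)

lemma C_props: "X \<in> Cpart B v \<Longrightarrow> v \<in> verts E \<Longrightarrow> X \<noteq> {} \<and> X \<subseteq> out_arcs E v \<and> finite X"
  using partC[of v] finC[OF CallI, of X v] by (auto simp: partition_on_def)

lemma D_props: "Y \<in> Dpart B v \<Longrightarrow> v \<in> verts E \<Longrightarrow> Y \<noteq> {} \<and> Y \<subseteq> in_arcs E v \<and> finite Y"
  using partD[of v] finD[OF DallI, of Y v] by (auto simp: partition_on_def)

lemma C_ex: assumes "e \<in> arcs E" shows "\<exists>X\<in>Call B. e \<in> X"
proof -
  have v: "tail E e \<in> verts E" using assms wfE by (simp add: wf_digraph.tail_in_verts)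
  have "e \<in> \<Union>(Cpart B (tail E e))"
    using partition_onD1[OF partC[OF v]] assms by (auto simp: out_arcs_def)
  then show ?thesis using CallI[OF _ v] by blast
qed

lemma D_ex: assumes "e \<in> arcs E" shows "\<exists>Y\<in>Dall B. e \<in> Y"
proof -
  have v: "head E e \<in> verts E" using assms wfE by (simp add: wf_digraph.head_in_verts)
  have "e \<in> \<Union>(Dpart B (head E e))"
    using partition_onD1[OF partD[OF v]] assms by (auto simp: in_arcs_def)
  then show ?thesis using DallI[OF _ v] by blast
qed

lemma C_inj: assumes "X \<in> Call B" "X' \<in> Call B" "e \<in> X" "e \<in> X'" shows "X = X'"
proof -
  obtain v where v: "v \<in> verts E" "X \<in> Cpart B v" using assms(1) by (rule CallE)
  obtain v' where v': "v' \<in> verts E" "X' \<in> Cpart B v'" using assms(2) by (rule CallE)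
  have "v = v'" using C_props[OF v(2,1)] C_props[OF v'(2,1)] assms by (auto simp: out_arcs_def)
  then show ?thesis
    using disjointD[OF partition_onD2[OF partC[OF v(1)]] v(2)] v' assms by blast
qed

lemma D_inj: assumes "X \<in> Dall B" "X' \<in> Dall B" "e \<in> X" "e \<in> X'" shows "X = X'"
proof -
  obtain v where v: "v \<in> verts E" "X \<in> Dpart B v" using assms(1) by (rule DallE)
  obtain v' where v': "v' \<in> verts E" "X' \<in> Dpart B v'" using assms(2) by (rule DallE)
  have "v = v'" using D_props[OF v(2,1)] D_props[OF v'(2,1)] assms by (auto simp: in_arcs_def)
  then show ?thesis
    using disjointD[OF partition_onD2[OF partD[OF v(1)]] v(2)] v' assms by blast
qed

lemma XY_unique:
  assumes "X \<in> Call B" "Y \<in> Dall B" "e \<in> X" "e \<in> Y"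
  shows "X \<inter> Y = {e}"
proof -
  have "finite (X \<inter> Y)" "card (X \<inter> Y) \<le> Suc 0"
    using card_XY[OF assms(1,2)] finC[OF assms(1)] by simp_all
  then have "\<forall>a\<in>X \<inter> Y. \<forall>b\<in>X \<inter> Y. a = b" using card_le_Suc0_iff_eq by blast
  then show ?thesis using assms(3,4) by blast
qed

lemma XY_eq:
  assumes "X \<in> Call B" "Y \<in> Dall B" "e \<in> X" "e \<in> Y"
  shows "XY X Y = gen (Inr (Edge e))" "XY_star Y X = gen (Inr (Ghost e))"
  using XY_unique[OF assms] by (auto simp: XY_def XY_star_def Int_commute)

lemma out_unique:
  "f \<in> out_arcs F w \<Longrightarrow> f' \<in> out_arcs F w \<Longrightarrow> X \<in> Call B \<Longrightarrow> amap \<phi> f \<in> X \<Longrightarrow> amap \<phi> f' \<in> X \<Longrightarrow> f = f'"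
proof -
  assume a: "f \<in> out_arcs F w" "f' \<in> out_arcs F w" "X \<in> Call B" "amap \<phi> f \<in> X" "amap \<phi> f' \<in> X"
  then obtain v where v: "v \<in> verts E" "X \<in> Cpart B v" by (auto simp: Call_def)
  have "vmap \<phi> w = v" using C_props[OF v(2,1)] a hom(3) by (auto simp: out_arcs_def)
  moreover have "w \<in> verts F" using a wf_digraph.tail_in_verts[OF wfF] by (auto simp: out_arcs_def)
  ultimately show ?thesis using rg_out[of w X] v a by blast
qed

lemma in_unique:
  "f \<in> in_arcs F w \<Longrightarrow> f' \<in> in_arcs F w \<Longrightarrow> X \<in> Dall B \<Longrightarrow> amap \<phi> f \<in> X \<Longrightarrow> amap \<phi> f' \<in> X \<Longrightarrow> f = f'"
proof -
  assume a: "f \<in> in_arcs F w" "f' \<in> in_arcs F w" "X \<in> Dall B" "amap \<phi> f \<in> X" "amap \<phi> f' \<in> X"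
  then obtain v where v: "v \<in> verts E" "X \<in> Dpart B v" by (auto simp: Dall_def)
  have "vmap \<phi> w = v" using D_props[OF v(2,1)] a hom(4) by (auto simp: in_arcs_def)
  moreover have "w \<in> verts F" using a wf_digraph.head_in_verts[OF wfF] by (auto simp: in_arcs_def)
  ultimately show ?thesis using rg_in[of w X] v a by blast
qed

lemma out_unique_edge: "f \<in> out_arcs F w \<Longrightarrow> f' \<in> out_arcs F w \<Longrightarrow> amap \<phi> f = amap \<phi> f' \<Longrightarrow> f = f'"
proof -
  assume a: "f \<in> out_arcs F w" "f' \<in> out_arcs F w" "amap \<phi> f = amap \<phi> f'"
  then have e: "amap \<phi> f \<in> arcs E" using hom by (auto simp: out_arcs_def)
  then obtain X where "X \<in> Call B" "amap \<phi> f \<in> X"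
    using C_ex[OF e] by blast
  then show ?thesis using out_unique a by metis
qed

lemma in_unique_edge: "f \<in> in_arcs F w \<Longrightarrow> f' \<in> in_arcs F w \<Longrightarrow> amap \<phi> f = amap \<phi> f' \<Longrightarrow> f = f'"
proof -
  assume a: "f \<in> in_arcs F w" "f' \<in> in_arcs F w" "amap \<phi> f = amap \<phi> f'"
  then have e: "amap \<phi> f \<in> arcs E" using hom by (auto simp: in_arcs_def)
  then obtain X where "X \<in> Dall B" "amap \<phi> f \<in> X"
    using D_ex[OF e] by blast
  then show ?thesis using in_unique a by metis
qed

lemma sigma_edge: "f \<in> out_arcs F w \<Longrightarrow> sigma F \<phi> (Inr (Edge (amap \<phi> f))) w = Poly_Mapping.single (head F f) 1"
  using out_unique_edge by (auto intro!: arg_cong2[of _ _ _ _ Poly_Mapping.single] arg_cong[of _ _ "head F"])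

lemma sigma_ghost: "f \<in> in_arcs F w \<Longrightarrow> sigma F \<phi> (Inr (Ghost (amap \<phi> f))) w = Poly_Mapping.single (tail F f) 1"
  using in_unique_edge by (auto intro!: arg_cong2[of _ _ _ _ Poly_Mapping.single] arg_cong[of _ _ "tail F"])

lemma sigma_edge_0: "(\<And>f. f \<in> out_arcs F w \<Longrightarrow> amap \<phi> f \<noteq> e) \<Longrightarrow> sigma F \<phi> (Inr (Edge e)) w = 0"
  and sigma_ghost_0: "(\<And>f. f \<in> in_arcs F w \<Longrightarrow> amap \<phi> f \<noteq> e) \<Longrightarrow> sigma F \<phi> (Inr (Ghost e)) w = 0"
  by auto

lemma sigma_V: "w \<in> verts F \<Longrightarrow> sigma F \<phi> g w \<in> (Vspace F :: ('w \<Rightarrow>\<^sub>0 'k::field) set)"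
proof -
  assume w: "w \<in> verts F"
  consider v where "g = Inl v" | e where "g = Inr (Edge e)" | e where "g = Inr (Ghost e)"
    by (metis dedge.exhaust sumE)
  then show ?thesis
  proof cases
    case 1 then show ?thesis using w by (auto simp: Vspace_simps)
  next
    case 2
    show ?thesis
    proof (cases "\<exists>f\<in>out_arcs F w. amap \<phi> f = e")
      case True
      then obtain f where "f \<in> out_arcs F w" "amap \<phi> f = e" by blast
      then have "sigma F \<phi> g w = Poly_Mapping.single (head F f) (1::'k)" "f \<in> arcs F"
        using sigma_edge[of f w] 2 by (simp_all add: out_arcs_def del: sigma.simps)
      then show ?thesis using wf_digraph.head_in_verts[OF wfF] by (simp add: Vspace_simps)
    next
      case False
      then show ?thesis using 2 sigma_edge_0 by (auto simp: Vspace_simps)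
    qed
  next
    case 3
    show ?thesis
    proof (cases "\<exists>f\<in>in_arcs F w. amap \<phi> f = e")
      case True
      then obtain f where "f \<in> in_arcs F w" "amap \<phi> f = e" by blast
      then have "sigma F \<phi> g w = Poly_Mapping.single (tail F f) (1::'k)" "f \<in> arcs F"
        using sigma_ghost[of f w] 3 by (simp_all add: in_arcs_def del: sigma.simps)
      then show ?thesis using wf_digraph.tail_in_verts[OF wfF] by (simp add: Vspace_simps)
    next
      case False
      then show ?thesis using 3 sigma_ghost_0 by (auto simp: Vspace_simps)
    qed
  qed
qed

abbreviation "act \<equiv> rho (sigma F \<phi>)"

lemma act_V: "x \<in> Vspace F \<Longrightarrow> act a x \<in> Vspace F"
proof -
  assume x: "x \<in> Vspace F"
  have "wact (sigma F \<phi>) us x \<in> Vspace F" for us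
    using x by (induction us arbitrary: x) (auto intro!: lin_ext_Vspace sigma_V simp del: sigma.simps)
  then show ?thesis unfolding rho_def lin_ext_def by (intro Vspace_sum Vspace_simps)
qed

lemma source_of: "X \<in> Cpart B v \<Longrightarrow> v \<in> verts E \<Longrightarrow> source_of B X = v"
  unfolding source_of_def using C_props[of X v] by (intro the_equality) (auto simp: out_arcs_def)

lemma range_of: "Y \<in> Dpart B v \<Longrightarrow> v \<in> verts E \<Longrightarrow> range_of B Y = v"
  unfolding range_of_def using D_props[of Y v] by (intro the_equality) (auto simp: in_arcs_def)

lemma fin_sum1: "X \<in> Call B \<Longrightarrow> finite {Y. Y \<in> Dall B \<and> X \<inter> Y \<noteq> {}}"
proof -
  assume X: "X \<in> Call B"
  let ?S = "{Y. Y \<in> Dall B \<and> X \<inter> Y \<noteq> {}}"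
  have fX: "finite X" using X by (rule finC)
  have "?S \<subseteq> (\<lambda>e. THE Y. Y \<in> Dall B \<and> e \<in> Y) ` X"
  proof
    fix Y assume "Y \<in> ?S"
    then obtain e where e: "e \<in> X" "e \<in> Y" "Y \<in> Dall B" by auto
    then have "Y = (THE Y. Y \<in> Dall B \<and> e \<in> Y)" using D_inj by (intro the_equality[symmetric]) auto
    then show "Y \<in> (\<lambda>e. THE Y. Y \<in> Dall B \<and> e \<in> Y) ` X" using e by blast
  qed
  then show ?thesis using fX finite_surj by blast
qed

lemma fin_sum2: "Y \<in> Dall B \<Longrightarrow> finite {X. X \<in> Call B \<and> Y \<inter> X \<noteq> {}}"
proof -
  assume Y: "Y \<in> Dall B"
  let ?S = "{X. X \<in> Call B \<and> Y \<inter> X \<noteq> {}}"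
  have fY: "finite Y" using Y by (rule finD)
  have "?S \<subseteq> (\<lambda>e. THE X. X \<in> Call B \<and> e \<in> X) ` Y"
  proof
    fix X assume "X \<in> ?S"
    then obtain e where e: "e \<in> X" "e \<in> Y" "X \<in> Call B" by auto
    then have "X = (THE X. X \<in> Call B \<and> e \<in> X)" using C_inj by (intro the_equality[symmetric]) auto
    then show "X \<in> (\<lambda>e. THE X. X \<in> Call B \<and> e \<in> X) ` Y" using e by blast
  qed
  then show ?thesis using fY finite_surj by blast
qed

lemma act_L1:
  assumes X: "X \<in> Call B" and X': "X' \<in> Call B" and w: "w \<in> verts F"
  shows "act ((\<Sum>Y | Y \<in> Dall B \<and> X \<inter> Y \<noteq> {}. XY X Y * XY_star Y X')
        - (if X = X' then gen (Inl (source_of B X)) else 0)) (Poly_Mapping.single w (1::'k::field)) = 0"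
proof -
  obtain v where v: "v \<in> verts E" "X \<in> Cpart B v" using X by (auto simp: Call_def)
  let ?S = "{Y. Y \<in> Dall B \<and> X \<inter> Y \<noteq> {}}"
  let ?t = "\<lambda>Y. act (XY X Y * XY_star Y X') (Poly_Mapping.single w (1::'k))"
  have "sum ?t ?S = (if X = X' \<and> vmap \<phi> w = v then Poly_Mapping.single w 1 else 0)"
  proof (cases "vmap \<phi> w = v")
    case False
    have "?t Y = 0" if Y: "Y \<in> ?S" for Y
    proof -
      obtain e where e: "e \<in> X" "e \<in> Y" using Y by blast
      have YD: "Y \<in> Dall B" using Y by blast
      have "sigma F \<phi> (Inr (Edge e)) w = (0 :: 'w \<Rightarrow>\<^sub>0 'k)"
        using e(1) C_props[OF v(2,1)] False hom(3) by (intro sigma_edge_0) (auto simp: out_arcs_def)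
      then show ?thesis by (simp add: rho_mult XY_eq(1)[OF X YD e(1,2)] del: sigma.simps)
    qed
    then show ?thesis using False by simp
  next
    case True
    then obtain f where f: "f \<in> out_arcs F w" "amap \<phi> f \<in> X"
      using rg_out[OF w, of X] v by blast
    let ?e = "amap \<phi> f"
    have eE: "?e \<in> arcs E" using f hom by (auto simp: out_arcs_def)
    obtain Y0 where Y0: "Y0 \<in> Dall B" "?e \<in> Y0"
      using D_ex[OF eE] by blast
    have S: "Y0 \<in> ?S" using Y0 f by auto
    have other: "?t Y = 0" if Y: "Y \<in> ?S" "Y \<noteq> Y0" for Y
    proof -
      obtain e where e: "e \<in> X" "e \<in> Y" using Y by blast
      have YD: "Y \<in> Dall B" using Y by blast
      have "e \<noteq> ?e" using D_inj[of Y Y0 e] Y e Y0 by auto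
      then have "sigma F \<phi> (Inr (Edge e)) w = (0 :: 'w \<Rightarrow>\<^sub>0 'k)"
        using out_unique[OF _ f(1) X _ f(2)] e by (intro sigma_edge_0) auto
      then show ?thesis by (simp add: rho_mult XY_eq(1)[OF X YD e(1,2)] del: sigma.simps)
    qed
    have in_f: "f \<in> in_arcs F (head F f)" using f by (auto simp: in_arcs_def out_arcs_def)
    have tf: "tail F f = w" using f by (auto simp: out_arcs_def)
    have "?t Y0 = (if X = X' then Poly_Mapping.single w 1 else 0)"
    proof (cases "X = X'")
      case True
      show ?thesis unfolding True[symmetric]
        by (simp add: rho_mult XY_eq[OF X Y0(1) f(2) Y0(2)] sigma_edge[OF f(1)] sigma_ghost[OF in_f] tf
            del: sigma.simps)
    next
      case False
      have "act (XY_star Y0 X') (Poly_Mapping.single (head F f) (1::'k)) = 0"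
      proof (cases "X' \<inter> Y0 = {}")
        case nz: False
        then obtain e where e: "e \<in> X'" "e \<in> Y0" by blast
        have "e \<noteq> ?e" using C_inj[OF X X' f(2)] e False by auto
        then have "sigma F \<phi> (Inr (Ghost e)) (head F f) = (0 :: 'w \<Rightarrow>\<^sub>0 'k)"
          using in_unique[OF _ in_f Y0(1) _ Y0(2)] e by (intro sigma_ghost_0) auto
        then show ?thesis by (simp add: XY_eq(2)[OF X' Y0(1) e] del: sigma.simps)
      qed (simp add: XY_star_def Int_commute)
      then show ?thesis using False
        by (simp add: rho_mult XY_eq(1)[OF X Y0(1) f(2) Y0(2)] sigma_edge[OF f(1)] del: sigma.simps)
    qed
    moreover have "sum ?t ?S = ?t Y0"
      using sum.remove[OF fin_sum1[OF X] S, of ?t] other by (simp add: sum.neutral)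
    ultimately show ?thesis using True by simp
  qed
  then show ?thesis using source_of[OF v(2,1)] by (auto simp: rho_diff_left rho_sum_left)
qed

lemma act_L2:
  assumes Y: "Y \<in> Dall B" and Y': "Y' \<in> Dall B" and w: "w \<in> verts F"
  shows "act ((\<Sum>X | X \<in> Call B \<and> Y \<inter> X \<noteq> {}. XY_star Y X * XY X Y')
        - (if Y = Y' then gen (Inl (range_of B Y)) else 0)) (Poly_Mapping.single w (1::'k::field)) = 0"
proof -
  obtain v where v: "v \<in> verts E" "Y \<in> Dpart B v" using Y by (auto simp: Dall_def)
  let ?S = "{X. X \<in> Call B \<and> Y \<inter> X \<noteq> {}}"
  let ?t = "\<lambda>X. act (XY_star Y X * XY X Y') (Poly_Mapping.single w (1::'k))"
  have "sum ?t ?S = (if Y = Y' \<and> vmap \<phi> w = v then Poly_Mapping.single w 1 else 0)"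
  proof (cases "vmap \<phi> w = v")
    case False
    have "?t X = 0" if X: "X \<in> ?S" for X
    proof -
      obtain e where e: "e \<in> Y" "e \<in> X" using X by blast
      have XC: "X \<in> Call B" using X by blast
      have "sigma F \<phi> (Inr (Ghost e)) w = (0 :: 'w \<Rightarrow>\<^sub>0 'k)"
        using e(1) D_props[OF v(2,1)] False hom(4) by (intro sigma_ghost_0) (auto simp: in_arcs_def)
      then show ?thesis by (simp add: rho_mult XY_eq(2)[OF XC Y e(2,1)] del: sigma.simps)
    qed
    then show ?thesis using False by simp
  next
    case True
    then obtain f where f: "f \<in> in_arcs F w" "amap \<phi> f \<in> Y"
      using rg_in[OF w, of Y] v by blast
    let ?e = "amap \<phi> f"
    have eE: "?e \<in> arcs E" using f hom by (auto simp: in_arcs_def)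
    obtain X0 where X0: "X0 \<in> Call B" "?e \<in> X0"
      using C_ex[OF eE] by blast
    have S: "X0 \<in> ?S" using X0 f by auto
    have other: "?t X = 0" if X: "X \<in> ?S" "X \<noteq> X0" for X
    proof -
      obtain e where e: "e \<in> X" "e \<in> Y" using X by blast
      have XC: "X \<in> Call B" using X by blast
      have "e \<noteq> ?e" using C_inj[of X X0 e] X e X0 by auto
      then have "sigma F \<phi> (Inr (Ghost e)) w = (0 :: 'w \<Rightarrow>\<^sub>0 'k)"
        using in_unique[OF _ f(1) Y _ f(2)] e by (intro sigma_ghost_0) auto
      then show ?thesis by (simp add: rho_mult XY_eq(2)[OF XC Y e(1,2)] del: sigma.simps)
    qed
    have out_f: "f \<in> out_arcs F (tail F f)" using f by (auto simp: in_arcs_def out_arcs_def)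
    have tf: "head F f = w" using f by (auto simp: in_arcs_def)
    have "?t X0 = (if Y = Y' then Poly_Mapping.single w 1 else 0)"
    proof (cases "Y = Y'")
      case True
      show ?thesis unfolding True[symmetric]
        by (simp add: rho_mult XY_eq[OF X0(1) Y X0(2) f(2)] sigma_ghost[OF f(1)] sigma_edge[OF out_f] tf
            del: sigma.simps)
    next
      case False
      have "act (XY X0 Y') (Poly_Mapping.single (tail F f) (1::'k)) = 0"
      proof (cases "X0 \<inter> Y' = {}")
        case nz: False
        then obtain e where e: "e \<in> X0" "e \<in> Y'" by blast
        have "e \<noteq> ?e" using D_inj[OF Y Y' f(2)] e False by auto
        then have "sigma F \<phi> (Inr (Edge e)) (tail F f) = (0 :: 'w \<Rightarrow>\<^sub>0 'k)"
          using out_unique[OF _ out_f X0(1) _ X0(2)] e by (intro sigma_edge_0) auto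
        then show ?thesis by (simp add: XY_eq(1)[OF X0(1) Y' e] del: sigma.simps)
      qed (simp add: XY_def)
      then show ?thesis using False
        by (simp add: rho_mult XY_eq(2)[OF X0(1) Y X0(2) f(2)] sigma_ghost[OF f(1)] del: sigma.simps)
    qed
    moreover have "sum ?t ?S = ?t X0"
      using sum.remove[OF fin_sum2[OF Y] S, of ?t] other by (simp add: sum.neutral)
    ultimately show ?thesis using True by simp
  qed
  then show ?thesis using range_of[OF v(2,1)] by (auto simp: rho_diff_left rho_sum_left)
qed

end

context bisep_rep
begin

lemma L_gens_iff: "Inl v \<in> L_gens B \<longleftrightarrow> v \<in> verts E" "Inr (Edge e) \<in> L_gens B \<longleftrightarrow> e \<in> arcs E"
  "Inr (Ghost e) \<in> L_gens B \<longleftrightarrow> e \<in> arcs E"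
  by (auto simp: L_gens_def path_gens_def double_graph_def)

lemma free_diff: "a \<in> free_algebra X \<Longrightarrow> b \<in> free_algebra X \<Longrightarrow> a - b \<in> free_algebra X"
  using free_algebra_simps(2)[of a X "- b"] free_algebra_simps(3)[of b X "-1"] by (simp add: scale_uminus)

lemma free_sum: "(\<And>i. i \<in> A \<Longrightarrow> f i \<in> free_algebra X) \<Longrightarrow> sum f A \<in> free_algebra X"
  by (induction A rule: infinite_finite_induct) (auto simp: free_algebra_simps)

lemma X_arcs: "X \<in> Call B \<Longrightarrow> X \<subseteq> arcs E"
  using C_props by (auto simp: Call_def out_arcs_def)

lemma XY_free1:
  assumes "X \<in> Call B" "Y \<in> Dall B"
  shows "XY X Y \<in> free_algebra (L_gens B)"
proof (cases "X \<inter> Y = {}")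
  case False
  then obtain e where e: "e \<in> X" "e \<in> Y" by blast
  then show ?thesis using X_arcs[OF assms(1)]
    by (auto simp: XY_eq[OF assms e] intro!: free_algebra_simps(5) simp: L_gens_iff)
qed (simp add: XY_def free_algebra_simps)

lemma XY_free2:
  assumes "X \<in> Call B" "Y \<in> Dall B"
  shows "XY_star Y X \<in> free_algebra (L_gens B)"
proof (cases "X \<inter> Y = {}")
  case False
  then obtain e where e: "e \<in> X" "e \<in> Y" by blast
  then show ?thesis using X_arcs[OF assms(1)]
    by (auto simp: XY_eq[OF assms e] intro!: free_algebra_simps(5) simp: L_gens_iff)
qed (simp add: XY_star_def free_algebra_simps Int_commute)

lemma L_rels_free: "(L_rels B :: ('v,'e,'k::field) Lfree set) \<subseteq> free_algebra (L_gens B)"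
proof
  fix r :: "('v,'e,'k) Lfree"
  let ?A = "free_algebra (L_gens B) :: ('v,'e,'k) Lfree set"
  assume "r \<in> L_rels B"
  then consider "r \<in> path_rels (double_graph E)" | "r \<in> L1_rels B" | "r \<in> L2_rels B"
    by (auto simp: L_rels_def)
  then show "r \<in> ?A"
  proof cases
    case 1
    have "tail (double_graph E) x \<in> verts E" "head (double_graph E) x \<in> verts E" "Inr x \<in> L_gens B"
      if "x \<in> arcs (double_graph E)" for x
      using that wf_digraph.tail_in_verts[OF wfE] wf_digraph.head_in_verts[OF wfE]
      by (auto simp: double_graph_def L_gens_iff)
    moreover have "verts (double_graph E) = verts E" by (simp add: double_graph_def)
    ultimately show ?thesis using 1
      by (auto simp: path_rels_def L_gens_iff intro!: free_diff free_algebra_simps split: if_splits)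
  next
    case 2
    then obtain X X' where X: "X \<in> Call B" "X' \<in> Call B" and
      r: "r = (\<Sum>Y | Y \<in> Dall B \<and> X \<inter> Y \<noteq> {}. XY X Y * XY_star Y X')
        - (if X = X' then gen (Inl (source_of B X)) else 0)"
      unfolding L1_rels_def by blast
    obtain v where v: "v \<in> verts E" "X \<in> Cpart B v" using X(1) by (rule CallE)
    show ?thesis unfolding r using X v source_of[OF v(2,1)]
      by (auto intro!: free_diff free_sum free_algebra_simps XY_free1 XY_free2 simp: L_gens_iff)
  next
    case 3
    then obtain Y Y' where Y: "Y \<in> Dall B" "Y' \<in> Dall B" and
      r: "r = (\<Sum>X | X \<in> Call B \<and> Y \<inter> X \<noteq> {}. XY_star Y X * XY X Y')
        - (if Y = Y' then gen (Inl (range_of B Y)) else 0)"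
      unfolding L2_rels_def by blast
    obtain v where v: "v \<in> verts E" "Y \<in> Dpart B v" using Y(1) by (rule DallE)
    show ?thesis unfolding r using Y v range_of[OF v(2,1)]
      by (auto intro!: free_diff free_sum free_algebra_simps XY_free1 XY_free2 simp: L_gens_iff)
  qed
qed

lemma act_path_rels:
  assumes "(r :: ('v,'e,'k::field) Lfree) \<in> path_rels (double_graph E)" and w: "w \<in> verts F"
  shows "act r (Poly_Mapping.single w 1) = 0"
proof -
  have src0: "sigma F \<phi> (Inr x) w = (0 :: 'w \<Rightarrow>\<^sub>0 'k)"
    if "x \<in> arcs (double_graph E)" "vmap \<phi> w \<noteq> tail (double_graph E) x" for x
    using that hom by (cases x) (auto simp: double_graph_def out_arcs_def in_arcs_def)
  have src: "lin_ext (sigma F \<phi> (Inr x)) (sigma F \<phi> (Inl (tail (double_graph E) x)) w)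
        = (sigma F \<phi> (Inr x) w :: 'w \<Rightarrow>\<^sub>0 'k)"
    if "x \<in> arcs (double_graph E)" for x
  proof (cases "vmap \<phi> w = tail (double_graph E) x")
    case False
    then have "sigma F \<phi> (Inr x) w = (0 :: 'w \<Rightarrow>\<^sub>0 'k)"
      using that hom by (cases x) (auto simp: double_graph_def out_arcs_def in_arcs_def)
    then show ?thesis using False by simp
  qed simp
  have rng: "lin_ext (sigma F \<phi> (Inl (head (double_graph E) x))) (sigma F \<phi> (Inr x) w)
        = (sigma F \<phi> (Inr x) w :: 'w \<Rightarrow>\<^sub>0 'k)"
    if "x \<in> arcs (double_graph E)" for x
  proof (cases "sigma F \<phi> (Inr x) w = (0 :: 'w \<Rightarrow>\<^sub>0 'k)")
    case False
    show ?thesis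
    proof (cases x)
      case (Edge e)
      then obtain f where f: "f \<in> out_arcs F w" "amap \<phi> f = e" using False sigma_edge_0 by metis
      have "sigma F \<phi> (Inr x) w = (Poly_Mapping.single (head F f) 1 :: 'w \<Rightarrow>\<^sub>0 'k)"
        unfolding Edge f(2)[symmetric] by (rule sigma_edge[OF f(1)])
      then show ?thesis using hom(4)[of f] f Edge by (auto simp: double_graph_def simp del: sigma.simps(2,3))
    next
      case (Ghost e)
      then obtain f where f: "f \<in> in_arcs F w" "amap \<phi> f = e" using False sigma_ghost_0 by metis
      have "sigma F \<phi> (Inr x) w = (Poly_Mapping.single (tail F f) 1 :: 'w \<Rightarrow>\<^sub>0 'k)"
        unfolding Ghost f(2)[symmetric] by (rule sigma_ghost[OF f(1)])
      then show ?thesis using hom(3)[of f] f Ghost by (auto simp: double_graph_def simp del: sigma.simps(2,3))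
    qed
  qed simp
  show ?thesis using assms(1) unfolding path_rels_def
    by (auto simp: rho_diff_left rho_mult src src0 rng simp del: sigma.simps(2,3))
qed

lemma act_ideal:
  "(a :: ('v,'e,'k::field) Lfree) \<in> ideal_gen (L_gens B) (L_rels B) \<Longrightarrow> x \<in> Vspace F \<Longrightarrow> act a x = 0"
proof (induction arbitrary: x rule: ideal_gen.induct)
  case (rel r)
  then consider "r \<in> path_rels (double_graph E)" | "r \<in> L1_rels B" | "r \<in> L2_rels B"
    by (auto simp: L_rels_def)
  then have "act r (Poly_Mapping.single w 1) = 0" if w: "w \<in> verts F" for w
  proof cases
    case 1
    then show ?thesis using w by (rule act_path_rels)
  next
    case 2
    then obtain X X' where "X \<in> Call B" "X' \<in> Call B" and
      "r = (\<Sum>Y | Y \<in> Dall B \<and> X \<inter> Y \<noteq> {}. XY X Y * XY_star Y X')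
        - (if X = X' then gen (Inl (source_of B X)) else 0)"
      unfolding L1_rels_def by blast
    then show ?thesis using act_L1 w by blast
  next
    case 3
    then obtain Y Y' where "Y \<in> Dall B" "Y' \<in> Dall B" and
      "r = (\<Sum>X | X \<in> Call B \<and> Y \<inter> X \<noteq> {}. XY_star Y X * XY X Y')
        - (if Y = Y' then gen (Inl (range_of B Y)) else 0)"
      unfolding L2_rels_def by blast
    then show ?thesis using act_L2 w by blast
  qed
  then show ?case using rel.prems by (rule rho_basis)
qed (auto simp: rho_add_left rho_scale_left rho_mult act_V)

lemma act_coset:
  "u \<in> coset (L_gens B) (L_rels B) a \<Longrightarrow> x \<in> Vspace F \<Longrightarrow> act u x = act a x"
  using act_ideal[of "u - a" x] by (simp add: coset_def rho_diff_left)

definition pi0 :: "('v,'e,'k::field) Lfree set \<Rightarrow> ('w \<Rightarrow>\<^sub>0 'k) \<Rightarrow> ('w \<Rightarrow>\<^sub>0 'k)" where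
  "pi0 = (\<lambda>U\<in>kcarrier (Lalg B). \<lambda>x\<in>Vspace F. act (SOME u. u \<in> U) x)"

lemma carrier_L: "kcarrier (Lalg B) = coset (L_gens B) (L_rels B) ` free_algebra (L_gens B)"
  by (simp add: Lalg_def presented_algebra_def)

lemma pi0_coset:
  assumes "a \<in> free_algebra (L_gens B)"
  shows "pi0 (coset (L_gens B) (L_rels B) a) = (\<lambda>x\<in>Vspace F. act a x)"
proof -
  have "(SOME u. u \<in> coset (L_gens B) (L_rels B) a) \<in> coset (L_gens B) (L_rels B) a"
    using coset_ne some_in_eq by blast
  then show ?thesis unfolding pi0_def carrier_L using assms act_coset
    by (auto simp: restrict_def fun_eq_iff)
qed

lemmas ops = presented_ops[OF L_rels_free, folded Lalg_def]

lemma is_pi_pi0: "is_pi B F \<phi> (pi0 :: ('v,'e,'k::field) Lfree set \<Rightarrow> _)"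
proof -
  have gens: "(pi0 :: ('v,'e,'k) Lfree set \<Rightarrow> _) (Lgen B g) = restrict (lin_ext (sigma F \<phi> g)) (Vspace F)" if "g \<in> L_gens B" for g
    using that unfolding Lgen_def by (subst pi0_coset) (auto simp: free_algebra_simps restrict_def)
  have "kalgebra_hom (Lalg B) (End_op (Vspace F)) (pi0 :: ('v,'e,'k) Lfree set \<Rightarrow> _)"
    unfolding kalgebra_hom_def
  proof (intro conjI ballI allI funcsetI)
    fix U :: "('v,'e,'k) Lfree set" assume "U \<in> kcarrier (Lalg B)"
    then obtain a where a: "a \<in> free_algebra (L_gens B)" "U = coset (L_gens B) (L_rels B) a"
      unfolding carrier_L by blast
    show "pi0 U \<in> kcarrier (End_op (Vspace F))"
      unfolding a(2) pi0_coset[OF a(1)]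
      by (auto simp: End_op_def Vspace_simps rho_add_right rho_scale_right act_V)
    fix c
    show "pi0 (ksmult (Lalg B) c U) = ksmult (End_op (Vspace F)) c (pi0 U)"
      unfolding a(2) using a(1)
      by (simp add: ops pi0_coset free_algebra_simps End_op_def rho_scale_left cong: restrict_cong)
    fix W :: "('v,'e,'k) Lfree set" assume "W \<in> kcarrier (Lalg B)"
    then obtain b where b: "b \<in> free_algebra (L_gens B)" "W = coset (L_gens B) (L_rels B) b"
      unfolding carrier_L by blast
    show "pi0 (kadd (Lalg B) U W) = kadd (End_op (Vspace F)) (pi0 U) (pi0 W)"
      unfolding a(2) b(2) using a(1) b(1)
      by (simp add: ops pi0_coset free_algebra_simps End_op_def rho_add_left cong: restrict_cong)
    show "pi0 (kmult (Lalg B) U W) = kmult (End_op (Vspace F)) (pi0 U) (pi0 W)"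
      unfolding a(2) b(2) using a(1) b(1)
      by (simp add: ops pi0_coset free_algebra_simps End_op_def rho_mult act_V cong: restrict_cong)
  qed
  moreover have "(pi0 :: ('v,'e,'k) Lfree set \<Rightarrow> _) \<in> extensional (kcarrier (Lalg B))"
    by (simp add: pi0_def)
  ultimately show ?thesis using gens unfolding is_pi_def by blast
qed

lemma is_pi_unique:
  assumes "is_pi B F \<phi> \<pi>" "is_pi B F \<phi> (\<pi>' :: ('v,'e,'k::field) Lfree set \<Rightarrow> _)"
  shows "\<pi> = \<pi>'"
proof -
  let ?c = "coset (L_gens B) (L_rels B) :: ('v,'e,'k) Lfree \<Rightarrow> _"
  let ?A = "free_algebra (L_gens B) :: ('v,'e,'k) Lfree set"
  let ?E = "End_op (Vspace F)"
  have h: "kalgebra_hom (Lalg B) ?E \<pi>" "kalgebra_hom (Lalg B) ?E \<pi>'"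
    and g: "\<And>g. g \<in> L_gens B \<Longrightarrow> \<pi> (?c (gen g)) = \<pi>' (?c (gen g))"
    using assms by (auto simp: is_pi_def Lgen_def)
  have inC: "a \<in> ?A \<Longrightarrow> ?c a \<in> kcarrier (Lalg B)" for a by (auto simp: carrier_L)
  have hadd: "p (?c (a + b)) = kadd ?E (p (?c a)) (p (?c b))"
    and hmult: "p (?c (a * b)) = kmult ?E (p (?c a)) (p (?c b))"
    and hscl: "p (?c (scale k a)) = ksmult ?E k (p (?c a))"
    if "kalgebra_hom (Lalg B) ?E p" "a \<in> ?A" "b \<in> ?A" for p a b k
    using that(1) inC[OF that(2)] inC[OF that(3)] ops[OF that(2,3)]
    by (simp_all add: kalgebra_hom_def flip: ops[OF that(2,3)])
  have add: "\<pi> (?c (a + b)) = \<pi>' (?c (a + b))"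
    if "a \<in> ?A" "b \<in> ?A" "\<pi> (?c a) = \<pi>' (?c a)" "\<pi> (?c b) = \<pi>' (?c b)" for a b
    using hadd[OF h(1) that(1,2)] hadd[OF h(2) that(1,2)] that(3,4) by simp
  have mult: "\<pi> (?c (a * b)) = \<pi>' (?c (a * b))"
    if "a \<in> ?A" "b \<in> ?A" "\<pi> (?c a) = \<pi>' (?c a)" "\<pi> (?c b) = \<pi>' (?c b)" for a b
    using hmult[OF h(1) that(1,2)] hmult[OF h(2) that(1,2)] that(3,4) by simp
  have scl: "\<pi> (?c (scale k a)) = \<pi>' (?c (scale k a))"
    if "a \<in> ?A" "\<pi> (?c a) = \<pi>' (?c a)" for a k
    using hscl[OF h(1) that(1,1), of k] hscl[OF h(2) that(1,1), of k] that(2) by simp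
  have zero: "\<pi> (?c 0) = \<pi>' (?c 0)"
  proof -
    have *: "p (?c 0) = (\<lambda>x\<in>Vspace F. 0)" if "kalgebra_hom (Lalg B) ?E p" for p
    proof -
      have "p (?c 0) = ksmult ?E 0 (p (?c 0))"
        using hscl[OF that free_algebra_simps(1) free_algebra_simps(1), of 0] by simp
      moreover have "ksmult ?E 0 h = (\<lambda>x\<in>Vspace F. 0)" for h
        by (simp add: End_op_def)
      ultimately show ?thesis by metis
    qed
    show ?thesis using *[OF h(1)] *[OF h(2)] by simp
  qed
  have word: "\<pi> (?c (Poly_Mapping.single (Word us) 1)) = \<pi>' (?c (Poly_Mapping.single (Word us) 1))"
    if "us \<noteq> []" "set us \<subseteq> L_gens B" for us
    using that
  proof (induction us)
    case (Cons u us)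
    show ?case
    proof (cases us)
      case Nil
      then show ?thesis using g[of u] Cons by (simp add: gen_def)
    next
      case (Cons u' us')
      have "Poly_Mapping.single (Word (u # us)) 1 = gen u * Poly_Mapping.single (Word us) (1::'k)"
        by (simp add: gen_def mult_single plus_free_monoid_def)
      moreover have "Poly_Mapping.single (Word us) 1 \<in> ?A"
        using Cons.prems Cons by (auto simp: free_algebra_def)
      ultimately show ?thesis using mult[of "gen u" "Poly_Mapping.single (Word us) 1"] g[of u]
          Cons.IH Cons.prems Cons by (auto simp: free_algebra_simps)
    qed
  qed simp
  have main: "\<pi> (?c a) = \<pi>' (?c a)" if a: "a \<in> ?A" for a
  proof -
    let ?s = "\<lambda>w. scale (Poly_Mapping.lookup a w) (Poly_Mapping.single w 1)"
    have w: "Poly_Mapping.single w 1 \<in> ?A \<and> \<pi> (?c (Poly_Mapping.single w 1)) = \<pi>' (?c (Poly_Mapping.single w 1))"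
      if "w \<in> Poly_Mapping.keys a" for w
      using word[of "letters w"] that a by (auto simp: free_algebra_def)
    have "sum ?s S \<in> ?A \<and> \<pi> (?c (sum ?s S)) = \<pi>' (?c (sum ?s S))" if "finite S" "S \<subseteq> Poly_Mapping.keys a" for S
      using that
    proof (induction S rule: finite_induct)
      case empty
      then show ?case by (simp add: zero free_algebra_simps)
    next
      case (insert w S)
      then show ?case using w[of w]
        by (simp add: add scl free_algebra_simps del: scale_single)
    qed
    from this[of "Poly_Mapping.keys a"] show ?thesis by (simp add: sum_singles del: scale_single)
  qed
  show ?thesis
  proof (rule extensionalityI)
    show "\<pi> \<in> extensional (kcarrier (Lalg B))" "\<pi>' \<in> extensional (kcarrier (Lalg B))"
      using assms by (auto simp: is_pi_def)
    show "\<And>U. U \<in> kcarrier (Lalg B) \<Longrightarrow> \<pi> U = \<pi>' U" unfolding carrier_L using main by blast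
  qed
qed

end

theorem is_pi_ex1:
  assumes "bi_separated B" "representation_graph B F \<phi>"
  shows "\<exists>!\<pi>. is_pi B F \<phi> \<pi>"
proof -
  interpret bisep_rep B F \<phi> using assms by (rule bisep_rep.intro)
  show ?thesis
  proof (rule ex1I)
    show "is_pi B F \<phi> pi0" by (rule is_pi_pi0)
    show "\<And>\<pi>. is_pi B F \<phi> \<pi> \<Longrightarrow> \<pi> = pi0" using is_pi_unique is_pi_pi0 by blast
  qed
qed

corollary is_pi_pi_hom:
  "bi_separated B \<Longrightarrow> representation_graph B F \<phi> \<Longrightarrow> is_pi B F \<phi> (pi_hom B F \<phi>)"
  unfolding pi_hom_def by (rule theI'[where P = "is_pi B F \<phi>"]) (rule is_pi_ex1)

end

theory Submission
  imports Defs
begin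

text \<open>
  Let \<open>V(T, \<zeta>) = N\<^sub>1 \<oplus> N\<^sub>2\<close>, let \<open>w\<close> be a vertex of \<open>T\<close> and split the basis vector \<open>w = a + b\<close> with
  \<open>a \<in> N\<^sub>1\<close>, \<open>b \<in> N\<^sub>2\<close>.  The claim is that \<open>a\<close> is a multiple of \<open>w\<close>.  Then \<open>w\<close> itself lies in one of the
  summands, and since \<open>T\<close> is connected and a walk from \<open>w\<close> to \<open>u\<close>, read in \<open>E\<close>, carries the basis
  vector \<open>w\<close> to \<open>u\<close>, that summand is everything.

  An element of the algebra that kills \<open>w\<close> kills \<open>a\<close>.  By the defining property of representation
  graphs this forces every vertex \<open>v\<close> in the support of \<open>a\<close> to admit exactly the same labelled walks
  as \<open>w\<close> (\<open>component_same_walks\<close>).  As \<open>T\<close> is a tree, \<open>w \<mapsto> v\<close> then extends to an automorphism of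
  \<open>(T, \<zeta>)\<close>, so the projection to \<open>N\<^sub>1\<close> is an idempotent of the group algebra of a group acting freely
  on a tree.  Such a group is free, free groups are left-orderable, and the group algebra of a
  left-ordered group has only trivial idempotents: if \<open>a\<close> had a vertex above \<open>w\<close>, the largest vertex
  occurring in the product \<open>a\<cdot>a\<close> would arise in one way only, hence would survive, and it would lie
  strictly above the largest vertex of \<open>a = a\<cdot>a\<close> (\<open>component_not_above\<close>); the same argument for the
  opposite order excludes vertices below \<open>w\<close>.

  The proof below carries this out without the group, directly with labelled walks.  Two ingredients
  are needed.

  \<^item> Closed walks in \<open>T\<close> reduce to the empty word (\<open>universal_covering_closed_lwalk\<close>).  The universal
    covering \<open>T\<close> maps to the covering of \<open>F\<close> obtained by attaching to each edge the corresponding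
    generator of a free group; following a closed walk in \<open>T\<close> shows that its label is trivial in that
    group.

  \<^item> The vertices of \<open>T\<close> carry a total order that depends only on labels
    (\<open>invariant_order_turn_less\<close>).  It compares \<open>u\<close> and \<open>v\<close> by counting, with signs, the turns and the
    edge directions along the reduced walk from \<open>u\<close> to \<open>v\<close>, an order due to Sunic.  The count is odd,
    which gives totality, and is additive up to an error of at most \<open>1\<close>, which gives transitivity.
\<close>

section \<open>Reduced words in edges and ghost edges\<close>

primrec inv_letter :: "'e dedge \<Rightarrow> 'e dedge" where
  "inv_letter (Edge e) = Ghost e"
| "inv_letter (Ghost e) = Edge e"

lemma inv_letter_invol [simp]: "inv_letter (inv_letter x) = x"
  by (cases x) auto

definition inv_word :: "'e dedge list \<Rightarrow> 'e dedge list" where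
  "inv_word p = rev (map inv_letter p)"

lemma inv_word_simps [simp]:
  "inv_word [] = []" "inv_word (x # p) = inv_word p @ [inv_letter x]"
  "inv_word (p @ q) = inv_word q @ inv_word p" "inv_word (inv_word p) = p"
  by (auto simp: inv_word_def rev_map[symmetric] comp_def)

abbreviation reduced :: "'e dedge list \<Rightarrow> bool" where
  "reduced \<equiv> successively (\<lambda>x y. y \<noteq> inv_letter x)"

lemma eq_inv_letter_commute: "x = inv_letter y \<longleftrightarrow> y = inv_letter x"
  by auto

lemma reduced_rev [simp]: "reduced (rev p) \<longleftrightarrow> reduced p"
  unfolding successively_rev by (rule successively_cong) (auto simp: eq_inv_letter_commute)

lemma reduced_inv_word [simp]: "reduced (inv_word p) \<longleftrightarrow> reduced p"
proof -
  have "reduced (map inv_letter p) \<longleftrightarrow> reduced p"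
    unfolding successively_map by (rule successively_cong) (auto simp: eq_inv_letter_commute)
  then show ?thesis by (simp add: inv_word_def del: successively_rev)
qed

text \<open>
  The part \<open>p'\<close> is what cancels in the product \<open>p r\<close>.  The words \<open>c\<close>, \<open>p'\<close>, \<open>q'\<close> are the legs of the
  tripod spanned in a tree by the starting point of \<open>p\<close>, its end, and the end of \<open>p r\<close>.
\<close>

lemma reduced_product_decomposition:
  assumes "reduced p" "reduced r"
  shows "\<exists>c p' q'. p = c @ p' \<and> r = inv_word p' @ q' \<and> reduced (c @ q')"
  using assms
proof (induction p arbitrary: r rule: rev_induct)
  case Nil
  then show ?case by (intro exI[of _ "[]"] exI[of _ r]) simp
next
  case (snoc x p)
  show ?case
  proof (cases "r \<noteq> [] \<and> hd r = inv_letter x")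
    case True
    then obtain r' where r: "r = inv_letter x # r'" by (cases r) auto
    have "reduced p" "reduced r'"
      using snoc.prems r by (auto simp: successively_append_iff successively_Cons)
    from snoc.IH[OF this] obtain c p' q' where
      *: "p = c @ p'" "r' = inv_word p' @ q'" "reduced (c @ q')" by blast
    show ?thesis
      by (rule exI[of _ c], rule exI[of _ "p' @ [x]"], rule exI[of _ q']) (simp add: * r)
  next
    case False
    then have "reduced ((p @ [x]) @ r)"
      using snoc.prems by (subst successively_append_iff) auto
    then show ?thesis
      by (intro exI[of _ "p @ [x]"] exI[of _ "[]"] exI[of _ r]) simp
  qed
qed

text \<open>
  The generators of the free group, acting on reduced words.  Words that are not reduced are left
  fixed, so that \<open>push x\<close> is a permutation of all lists; the free group is used only through these
  permutations, so no multiplication of reduced words has to be defined.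
\<close>

definition push :: "'e dedge \<Rightarrow> 'e dedge list \<Rightarrow> 'e dedge list" where
  "push x w = (if \<not> reduced w then w else if w \<noteq> [] \<and> hd w = inv_letter x then tl w else x # w)"

lemma reduced_push [simp]: "reduced (push x w) \<longleftrightarrow> reduced w"
proof (cases "reduced w")
  case True
  then show ?thesis by (cases w) (auto simp: push_def successively_Cons)
qed (simp add: push_def)

lemma push_inv_letter [simp]: "push (inv_letter x) (push x w) = w"
proof (cases "reduced w")
  case True
  then show ?thesis by (cases w) (auto simp: push_def successively_Cons)
qed (simp add: push_def)

lemma fold_push_inv_word: "fold push (inv_word p) (fold push p w) = w"
  by (induction p arbitrary: w) auto

text \<open>
  The action puts the latest letter in front, which is why the result has to be reversed.
\<close>

definition normal_form :: "'e dedge list \<Rightarrow> 'e dedge list" where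
  "normal_form p = rev (fold push p [])"

lemma reduced_normal_form: "reduced (normal_form p)"
proof -
  have "reduced w \<Longrightarrow> reduced (fold push p w)" for w
    by (induction p arbitrary: w) auto
  then show ?thesis by (simp add: normal_form_def del: successively_rev)
qed

text \<open>
  Acting on the empty word rebuilds a reduced word letter by letter.  Hence a nonempty reduced word is a
  nontrivial permutation, which is the freeness needed below.
\<close>

lemma normal_form_reduced: "reduced p \<Longrightarrow> normal_form p = p"
proof (induction p rule: rev_induct)
  case (snoc x p)
  then have p: "reduced p" "p \<noteq> [] \<longrightarrow> x \<noteq> inv_letter (last p)"
    by (auto simp: successively_append_iff)
  then have "fold push p [] = rev p" using snoc.IH by (metis normal_form_def rev_swap)
  moreover have "reduced (rev p)" using p by (simp del: successively_rev)
  moreover have "p \<noteq> [] \<longrightarrow> hd (rev p) \<noteq> inv_letter x"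
    using p(2) by (auto simp: hd_rev)
  ultimately show ?case by (auto simp: normal_form_def push_def)
qed (simp add: normal_form_def)

section \<open>The weight of a word\<close>

text \<open>
  The sign of the comparison of \<open>a\<close> and \<open>b\<close> in some fixed total order of the type; the order is chosen
  as a well-order only because these always exist.
\<close>

definition turn :: "'a \<Rightarrow> 'a \<Rightarrow> int" where
  "turn a b = (if a = b then 0 else if (a, b) \<in> (SOME r. well_order_on UNIV r) then 1 else - 1)"

lemma turn_order:
  obtains r :: "'a rel" where "total_on UNIV r" "antisym r" "trans r"
    "\<And>a b. turn a b = (if a = b then 0 else if (a, b) \<in> r then 1 else - 1)"
proof -
  have "well_order_on UNIV (SOME r :: 'a rel. well_order_on UNIV r)"
    by (rule someI_ex) (rule well_order_on)
  then show ?thesis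
    by (intro that[of "SOME r :: 'a rel. well_order_on UNIV r"])
      (auto simp: turn_def well_order_on_def linear_order_on_def partial_order_on_def preorder_on_def)
qed

lemma turn_self [simp]: "turn a a = 0"
  by (simp add: turn_def)

lemma turn_swap: "turn b a = - turn a b"
proof -
  obtain r :: "'a rel" where "total_on UNIV r" "antisym r"
    "\<And>a b. turn a b = (if a = b then 0 else if (a, b) \<in> r then 1 else - 1)"
    by (rule turn_order) blast
  then show ?thesis by (auto simp: total_on_def dest: antisymD)
qed

lemma turn_odd: "a \<noteq> b \<Longrightarrow> odd (turn a b)"
  by (simp add: turn_def)

text \<open>
  If two of the three elements agree the sum is zero; otherwise the three comparisons of a linear
  order cannot all point the same way round, so two of them cancel.
\<close>

lemma turn_triangle: "\<bar>turn a b + turn b c + turn c a\<bar> \<le> 1"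
proof -
  obtain r :: "'a rel" where r: "total_on UNIV r" "antisym r" "trans r"
    and t: "\<And>a b. turn a b = (if a = b then 0 else if (a, b) \<in> r then 1 else - 1)"
    by (rule turn_order) blast
  have 1: "x = y \<or> (x, y) \<in> r \<or> (y, x) \<in> r" for x y using r(1) by (auto simp: total_on_def)
  have 2: "(x, y) \<in> r \<Longrightarrow> (y, x) \<in> r \<Longrightarrow> x = y" for x y using r(2) by (auto dest: antisymD)
  have 3: "(x, y) \<in> r \<Longrightarrow> (y, z) \<in> r \<Longrightarrow> (x, z) \<in> r" for x y z using r(3) by (rule transD)
  show ?thesis
    unfolding t using 1[of a b] 1[of b c] 1[of c a] 2[of a b] 2[of b c] 2[of c a]
      3[of a b c] 3[of b c a] 3[of c a b] 3[of c b a] 3[of b a c] 3[of a c b]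
    by (smt (verit))
qed

primrec orientation :: "'e dedge \<Rightarrow> int" where
  "orientation (Edge e) = 1"
| "orientation (Ghost e) = - 1"

lemma orientation_inv_letter [simp]: "orientation (inv_letter x) = - orientation x"
  by (cases x) auto

lemma orientation_odd: "odd (orientation x)"
  by (cases x) auto

text \<open>
  The signed number of turns and edge directions along a walk that is entered from direction \<open>a\<close> and
  left in direction \<open>b\<close>.  A direction at a vertex is the label of a step leaving it, and \<open>None\<close> stands for
  the vertex itself, at which a walk starts or ends.  Reversing the walk changes all signs.
\<close>

fun turning_between :: "'e dedge option \<Rightarrow> 'e dedge list \<Rightarrow> 'e dedge option \<Rightarrow> int" where
  "turning_between a [] b = turn a b"
| "turning_between a (x # p) b =
     turn a (Some x) + orientation x + turning_between (Some (inv_letter x)) p b"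

abbreviation weight :: "'e dedge list \<Rightarrow> int" where
  "weight p \<equiv> turning_between None p None"

lemma turning_between_snoc:
  "turning_between a (p @ [x]) b = turning_between a p (Some x) + orientation x + turn (Some (inv_letter x)) b"
  by (induction p arbitrary: a) auto

lemma turning_between_inv_word: "turning_between b (inv_word p) a = - turning_between a p b"
  by (induction p arbitrary: a) (auto simp: turning_between_snoc turn_swap[of b] turn_swap[of _ "Some _"])

text \<open>
  A reduced word with \<open>n > 0\<close> letters contributes \<open>n\<close> edge directions and \<open>n + 1\<close> turns, none of which is
  zero since the word is reduced; this is an odd number of odd summands.
\<close>

lemma weight_reduced_nonzero: "reduced p \<Longrightarrow> p \<noteq> [] \<Longrightarrow> weight p \<noteq> 0"
proof -
  have *: "reduced (x # p) \<Longrightarrow> odd (turning_between (Some (inv_letter x)) p None)" for x and p :: "'a dedge list"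
  proof (induction p arbitrary: x)
    case (Cons y p)
    then have "odd (turn (Some (inv_letter x)) (Some y))" by (intro turn_odd) auto
    then show ?case using Cons orientation_odd[of y] by (auto simp: successively_Cons)
  qed (simp add: turn_odd)
  assume "reduced p" "p \<noteq> []"
  then obtain x q where "p = x # q" "reduced (x # q)" by (cases p) auto
  then have "odd (weight p)"
    using *[of x q] orientation_odd[of x] turn_odd[of None "Some x"] by simp
  then show ?thesis by auto
qed

text \<open>
  Each of the three walks runs from the end of one leg of a tripod to the end of another one.  The
  contributions of the legs cancel; what remains are the three turns at the centre.
\<close>

lemma weight_tripod: "\<bar>weight (c @ p) + weight (inv_word p @ q) - weight (c @ q)\<bar> \<le> 1"
proof -
  (* The direction in which a leg leaves the centre, and what the leg contributes beyond its turn there. *)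
  define dir :: "'a dedge list \<Rightarrow> 'a dedge option" where "dir p = (if p = [] then None else Some (hd p))" for p
  define leg where "leg p = (if p = [] then 0 else
    orientation (hd p) + turning_between (Some (inv_letter (hd p))) (tl p) None)" for p :: "'a dedge list"
  have leg: "turning_between a p None = turn a (dir p) + leg p" for a and p :: "'a dedge list"
    by (cases p) (auto simp: dir_def leg_def)
  have app: "turning_between a (p @ q) None = turning_between a p (dir q) + leg q"
    for a and p q :: "'a dedge list"
  proof (induction p arbitrary: a)
    case Nil
    show ?case by (simp add: leg)
  qed simp
  have rev: "turning_between None p b = - (turn b (dir (inv_word p)) + leg (inv_word p))"
    for b and p :: "'a dedge list"
    using turning_between_inv_word[of None "inv_word p" b] leg[of b "inv_word p"] by simp
  show ?thesis
    using turn_triangle[of "dir (inv_word c)" "dir p" "dir q"]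
    by (simp add: app rev turn_swap[of "dir p" "dir (inv_word c)"] turn_swap[of "dir q" "dir p"]
        turn_swap[of "dir q" "dir (inv_word c)"])
qed

section \<open>Walks recorded by their labels\<close>

text \<open>
  Steps and walks are described by their labels only, \<open>lab\<close> being the labelling of the edges.  In a
  representation graph labels determine the walk, and only labels can be compared between different
  starting points.
\<close>

definition dstep :: "('v,'f) pre_digraph \<Rightarrow> ('f \<Rightarrow> 'e) \<Rightarrow> 'v \<Rightarrow> 'e dedge \<Rightarrow> 'v \<Rightarrow> bool" where
  "dstep G lab u x v \<longleftrightarrow> (\<exists>f\<in>arcs G. x = Edge (lab f) \<and> tail G f = u \<and> head G f = v \<or>
                              x = Ghost (lab f) \<and> head G f = u \<and> tail G f = v)"

primrec lwalk :: "('v,'f) pre_digraph \<Rightarrow> ('f \<Rightarrow> 'e) \<Rightarrow> 'v \<Rightarrow> 'e dedge list \<Rightarrow> 'v \<Rightarrow> bool" where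
  "lwalk G lab u [] v \<longleftrightarrow> u = v \<and> u \<in> verts G"
| "lwalk G lab u (x # p) v \<longleftrightarrow> (\<exists>m. dstep G lab u x m \<and> lwalk G lab m p v)"

lemma dstep_inv_letter: "dstep G lab u x v \<Longrightarrow> dstep G lab v (inv_letter x) u"
  by (auto simp: dstep_def)

context wf_digraph
begin

lemma dstep_verts: "dstep G lab u x v \<Longrightarrow> u \<in> verts G \<and> v \<in> verts G"
  by (auto simp: dstep_def)

lemma lwalk_verts: "lwalk G lab u p v \<Longrightarrow> u \<in> verts G \<and> v \<in> verts G"
  by (induction p arbitrary: u) (auto dest: dstep_verts)

lemma lwalk_append:
  "lwalk G lab u (p @ q) v \<longleftrightarrow> (\<exists>m. lwalk G lab u p m \<and> lwalk G lab m q v)"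
  by (induction p arbitrary: u) (auto dest: lwalk_verts)

lemma lwalk_snoc: "lwalk G lab u (p @ [x]) v \<longleftrightarrow> (\<exists>m. lwalk G lab u p m \<and> dstep G lab m x v)"
  by (auto simp: lwalk_append dest: dstep_verts)

lemma lwalk_inv_word: "lwalk G lab u p v \<Longrightarrow> lwalk G lab v (inv_word p) u"
  by (induction p arbitrary: u) (auto simp: lwalk_snoc dest: dstep_inv_letter)

lemma lwalk_imp_awalk: "lwalk G lab u q v \<Longrightarrow> \<exists>p. pre_digraph.awalk (double_graph G) u p v"
proof (induction q arbitrary: u)
  case Nil
  then show ?case
    by (intro exI[of _ "[]"]) (auto simp: pre_digraph.awalk_def pre_digraph.cas.simps double_simps)
next
  case (Cons x q)
  then obtain m p where m: "dstep G lab u x m" "pre_digraph.awalk (double_graph G) m p v"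
    by (metis lwalk.simps(2))
  then obtain y where "y \<in> arcs (double_graph G)" "tail (double_graph G) y = u" "head (double_graph G) y = m"
    unfolding dstep_def by (metis double_simps(2-7))
  then show ?case
    using m dstep_verts[OF m(1)]
    by (intro exI[of _ "y # p"]) (auto simp: pre_digraph.awalk_def pre_digraph.cas.simps double_simps)
qed

lemma awalk_imp_lwalk: "pre_digraph.awalk (double_graph G) u p v \<Longrightarrow> \<exists>q. lwalk G lab u q v"
proof (induction p arbitrary: u)
  case Nil
  then show ?case
    by (intro exI[of _ "[]"]) (auto simp: pre_digraph.awalk_def pre_digraph.cas.simps double_simps)
next
  case (Cons y p)
  then have y: "y \<in> arcs (double_graph G)" "tail (double_graph G) y = u"
    and "pre_digraph.awalk (double_graph G) (head (double_graph G) y) p v"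
    by (cases y; auto simp: pre_digraph.awalk_def pre_digraph.cas.simps double_simps)+
  then obtain q where q: "lwalk G lab (head (double_graph G) y) q v" using Cons.IH by blast
  have "dstep G lab u (map_dedge lab y) (head (double_graph G) y)"
    using y by (cases y) (auto simp: dstep_def double_simps)
  then show ?case using q by (intro exI[of _ "map_dedge lab y # q"]) auto
qed

end

lemma connected_graph_lwalk:
  "connected_graph G \<longleftrightarrow> wf_digraph G \<and> verts G \<noteq> {} \<and>
     (\<forall>u\<in>verts G. \<forall>v\<in>verts G. \<exists>p. lwalk G lab u p v)"
  unfolding connected_graph_def
  using wf_digraph.lwalk_imp_awalk[of G lab] wf_digraph.awalk_imp_lwalk[of G _ _ _ lab] by metis

section \<open>A covering that detects reduced words\<close>

text \<open>
  The derived graph of the voltage assignment \<open>f \<mapsto> push (Edge (lab f))\<close> with values in the free group,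
  restricted to the connected component of \<open>(v0, id)\<close>: its vertices are the pairs reached by lifting
  walks that start at \<open>v0\<close>.
\<close>

definition free_cover :: "('v,'f) pre_digraph \<Rightarrow> ('f \<Rightarrow> 'e) \<Rightarrow> 'v \<Rightarrow>
    ('v \<times> ('e dedge list \<Rightarrow> 'e dedge list), 'f \<times> ('e dedge list \<Rightarrow> 'e dedge list)) pre_digraph" where
  "free_cover G lab v0 = \<lparr>
     verts = {(v, fold push p) | v p. lwalk G lab v0 p v},
     arcs = {(f, fold push p) | f p. f \<in> arcs G \<and> lwalk G lab v0 p (tail G f)},
     tail = (\<lambda>(f, h). (tail G f, h)),
     head = (\<lambda>(f, h). (head G f, push (Edge (lab f)) \<circ> h)) \<rparr>"

lemma fold_push_snoc: "push x \<circ> fold push p = fold push (p @ [x])"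
  by auto

lemma free_cover_step:
  assumes "wf_digraph G" "dstep G lab v x v'" "lwalk G lab v0 p v"
  shows "dstep (free_cover G lab v0) (lab \<circ> fst) (v, fold push p) x (v', fold push (p @ [x]))"
proof -
  interpret wf_digraph G by fact
  obtain f where f: "f \<in> arcs G"
    "x = Edge (lab f) \<and> tail G f = v \<and> head G f = v' \<or> x = Ghost (lab f) \<and> head G f = v \<and> tail G f = v'"
    using assms(2) by (auto simp: dstep_def)
  show ?thesis using f(2)
  proof
    assume x: "x = Edge (lab f) \<and> tail G f = v \<and> head G f = v'"
    then show ?thesis
      unfolding dstep_def using f(1) assms(3)
      by (intro bexI[of _ "(f, fold push p)"]) (auto simp: free_cover_def)
  next
    assume x: "x = Ghost (lab f) \<and> head G f = v \<and> tail G f = v'"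
    have w: "lwalk G lab v0 (p @ [x]) v'" using assms lwalk_snoc by blast
    have "push (Edge (lab f)) \<circ> fold push (p @ [x]) = fold push p"
      using x push_inv_letter[of x] by (simp add: fun_eq_iff)
    moreover have "(f, fold push (p @ [x])) \<in> arcs (free_cover G lab v0)"
      using w x f(1) unfolding free_cover_def by (auto simp del: fold_append)
    ultimately show ?thesis
      unfolding dstep_def using x by (intro bexI[of _ "(f, fold push (p @ [x]))"]) (auto simp: free_cover_def simp del: fold_append)
  qed
qed

lemma free_cover_lwalk:
  assumes "wf_digraph G" "lwalk G lab v q v'" "lwalk G lab v0 p v"
  shows "lwalk (free_cover G lab v0) (lab \<circ> fst) (v, fold push p) q (v', fold push (p @ q))"
  using assms(2,3)
proof (induction q arbitrary: v p)
  case Nil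
  then show ?case by (auto simp: free_cover_def)
next
  case (Cons x q)
  then obtain m where m: "dstep G lab v x m" "lwalk G lab m q v'" by auto
  then have "lwalk G lab v0 (p @ [x]) m"
    using Cons.prems(2) wf_digraph.lwalk_snoc[OF assms(1)] by blast
  from Cons.IH[OF m(2) this] free_cover_step[OF assms(1) m(1) Cons.prems(2)]
  show ?case unfolding lwalk.simps by (metis append.assoc append_Cons append_Nil)
qed

lemma covering_free_cover:
  assumes conn: "connected_graph G" and v0: "v0 \<in> verts G"
  shows "covering G (free_cover G lab v0) \<lparr> vmap = fst, amap = fst \<rparr>"
proof -
  interpret wf_digraph G using conn by (simp add: connected_graph_def)
  let ?U = "free_cover G lab v0"
  have wfU: "wf_digraph ?U"
  proof
    fix a assume "a \<in> arcs ?U"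
    then obtain f p where f: "a = (f, fold push p)" "f \<in> arcs G" "lwalk G lab v0 p (tail G f)"
      by (auto simp: free_cover_def)
    then show "tail ?U a \<in> verts ?U" by (auto simp: free_cover_def)
    have "dstep G lab (tail G f) (Edge (lab f)) (head G f)" using f by (auto simp: dstep_def)
    then have "lwalk G lab v0 (p @ [Edge (lab f)]) (head G f)" using f lwalk_snoc by blast
    moreover have "head ?U a = (head G f, fold push (p @ [Edge (lab f)]))"
      by (simp add: f free_cover_def)
    ultimately show "head ?U a \<in> verts ?U" by (auto simp: free_cover_def simp del: fold_append)
  qed
  (* Connectedness: every vertex is joined to the base point by the lift of the walk that defines it. *)
  have base: "lwalk ?U (lab \<circ> fst) (v0, fold push []) p (v, fold push p)" if "lwalk G lab v0 p v" for p v
    using free_cover_lwalk[OF wf_digraph_axioms that, of v0 "[]"] v0 by simp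
  have connU: "connected_graph ?U"
    unfolding connected_graph_lwalk[where lab = "lab \<circ> fst"]
  proof (intro conjI ballI)
    show "wf_digraph ?U" by (rule wfU)
    show "verts ?U \<noteq> {}" using v0 by (auto simp: free_cover_def intro!: exI[of _ "[]"])
    fix a b assume "a \<in> verts ?U" "b \<in> verts ?U"
    then obtain v p v' p' where "a = (v, fold push p)" "b = (v', fold push p')"
      "lwalk G lab v0 p v" "lwalk G lab v0 p' v'" by (auto simp: free_cover_def)
    then have "lwalk ?U (lab \<circ> fst) a (inv_word p) (v0, fold push [])"
      "lwalk ?U (lab \<circ> fst) (v0, fold push []) p' b"
      using base wf_digraph.lwalk_inv_word[OF wfU] by blast+
    then show "\<exists>q. lwalk ?U (lab \<circ> fst) a q b"
      using wf_digraph.lwalk_append[OF wfU] by blast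
  qed
  have hom: "graph_hom ?U G \<lparr> vmap = fst, amap = fst \<rparr>"
    by (auto simp: graph_hom_def free_cover_def dest: lwalk_verts)
  have out: "bij_betw fst (out_arcs ?U a) (out_arcs G (fst a))"
    and in': "bij_betw fst (in_arcs ?U a) (in_arcs G (fst a))" if a: "a \<in> verts ?U" for a
  proof -
    obtain v p where v: "a = (v, fold push p)" "lwalk G lab v0 p v"
      using a by (auto simp: free_cover_def)
    show "bij_betw fst (out_arcs ?U a) (out_arcs G (fst a))"
      by (rule bij_betw_byWitness[where f' = "\<lambda>f. (f, fold push p)"])
        (use v in \<open>auto simp: free_cover_def out_arcs_def\<close>)
    have arcI: "(f, push (Ghost (lab f)) \<circ> fold push p) \<in> in_arcs ?U a" if f: "f \<in> in_arcs G v" for f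
    proof -
      have "dstep G lab v (Ghost (lab f)) (tail G f)" using f by (auto simp: dstep_def)
      then have "lwalk G lab v0 (p @ [Ghost (lab f)]) (tail G f)" using v lwalk_snoc by blast
      then have "(f, fold push (p @ [Ghost (lab f)])) \<in> arcs ?U"
        using f unfolding free_cover_def by (auto simp del: fold_append)
      then show ?thesis
        using f v push_inv_letter[of "Ghost (lab f)"]
        by (auto simp: in_arcs_def free_cover_def fun_eq_iff simp flip: fold_push_snoc)
    qed
    show "bij_betw fst (in_arcs ?U a) (in_arcs G (fst a))"
    proof (rule bij_betw_byWitness[where f' = "\<lambda>f. (f, push (Ghost (lab f)) \<circ> fold push p)"])
      show "\<forall>b\<in>in_arcs ?U a. (fst b, push (Ghost (lab (fst b))) \<circ> fold push p) = b"
      proof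
        fix b assume "b \<in> in_arcs ?U a"
        then obtain f h where b: "b = (f, h)" "push (Edge (lab f)) \<circ> h = fold push p"
          using v by (auto simp: in_arcs_def free_cover_def)
        show "(fst b, push (Ghost (lab (fst b))) \<circ> fold push p) = b"
          using b(1) push_inv_letter[of "Edge (lab f)"] unfolding b(2)[symmetric] by (simp add: fun_eq_iff)
      qed
      show "fst ` in_arcs ?U a \<subseteq> in_arcs G (fst a)"
        using v by (auto simp: in_arcs_def free_cover_def)
      show "(\<lambda>f. (f, push (Ghost (lab f)) \<circ> fold push p)) ` in_arcs G (fst a) \<subseteq> in_arcs ?U a"
        using arcI v by auto
    qed auto
  qed
  show ?thesis unfolding covering_def using connU hom out in' by simp
qed

text \<open>
  A morphism from \<open>T\<close> to the covering above assigns to every vertex a permutation, which is multiplied by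
  \<open>push x\<close> along a step with label \<open>x\<close>.  Going round a closed walk reproduces the permutation, so the
  label of the walk acts trivially.
\<close>

lemma universal_covering_closed_lwalk:
  assumes conn: "connected_graph G" and univ: "universal_covering G T \<tau>"
    and walk: "lwalk T (lab \<circ> amap \<tau>) t p t"
  shows "normal_form p = []"
proof -
  obtain v0 where v0: "v0 \<in> verts G" using conn by (auto simp: connected_graph_def)
  let ?U = "free_cover G lab v0"
  obtain \<alpha> where \<alpha>: "morphism_over T \<tau> ?U \<lparr> vmap = fst, amap = fst \<rparr> \<alpha>"
    using universal_covering_morphism[OF univ covering_free_cover[OF conn v0]] by blast
  have arc: "snd (vmap \<alpha> (head T f)) = push (Edge (lab (amap \<tau> f))) \<circ> snd (vmap \<alpha> (tail T f))"
    if f: "f \<in> arcs T" for f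
  proof -
    have "fst (amap \<alpha> f) = amap \<tau> f" "tail ?U (amap \<alpha> f) = vmap \<alpha> (tail T f)"
      "head ?U (amap \<alpha> f) = vmap \<alpha> (head T f)"
      using \<alpha> f by (auto simp: morphism_over_def graph_hom_def comp_map_def)
    then show ?thesis by (cases "amap \<alpha> f") (auto simp: free_cover_def simp flip: \<open>head ?U _ = _\<close> \<open>tail ?U _ = _\<close>)
  qed
  have step: "snd (vmap \<alpha> v) = push x \<circ> snd (vmap \<alpha> u)" if xs: "dstep T (lab \<circ> amap \<tau>) u x v" for u x v
  proof -
    from xs obtain f where f: "f \<in> arcs T"
      and "x = Edge (lab (amap \<tau> f)) \<and> tail T f = u \<and> head T f = v \<or>
           x = Ghost (lab (amap \<tau> f)) \<and> head T f = u \<and> tail T f = v"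
      by (auto simp: dstep_def)
    then show ?thesis
      using arc[OF f] push_inv_letter[of "Edge (lab (amap \<tau> f))"] by (auto simp: fun_eq_iff)
  qed
  have lw: "lwalk T (lab \<circ> amap \<tau>) u q v \<Longrightarrow> snd (vmap \<alpha> v) = fold push q \<circ> snd (vmap \<alpha> u)" for u q v
    by (induction q arbitrary: u) (auto dest!: step simp: comp_assoc)
  have "wf_digraph T" using univ by (auto simp: universal_covering_def covering_def connected_graph_def)
  then have "t \<in> verts T" using walk wf_digraph.lwalk_verts by fast
  then have "vmap \<alpha> t \<in> verts ?U" using \<alpha> by (auto simp: morphism_over_def graph_hom_def)
  then obtain q where q: "snd (vmap \<alpha> t) = fold push q" by (auto simp: free_cover_def)
  (* The permutation at t is surjective; the argument is chosen to be mapped to the empty word. *)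
  have "fold push p (fold push q (fold push (inv_word q) [])) = fold push q (fold push (inv_word q) [])"
    using lw[OF walk] unfolding q by (metis comp_apply)
  moreover have "fold push q (fold push (inv_word q) []) = []"
    using fold_push_inv_word[of "inv_word q" "[]"] by simp
  ultimately show ?thesis by (simp add: normal_form_def)
qed

section \<open>An invariant order on the vertices of a simply connected representation graph\<close>

context bisep_rep
begin

abbreviation walk :: "'w \<Rightarrow> 'e dedge list \<Rightarrow> 'w \<Rightarrow> bool" where
  "walk \<equiv> lwalk F (amap \<phi>)"

lemmas walk_verts = wf_digraph.lwalk_verts[OF wfF]
  and walk_append = wf_digraph.lwalk_append[OF wfF]
  and walk_snoc = wf_digraph.lwalk_snoc[OF wfF]
  and walk_inv_word = wf_digraph.lwalk_inv_word[OF wfF]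

lemma walk_exists: "u \<in> verts F \<Longrightarrow> v \<in> verts F \<Longrightarrow> \<exists>p. walk u p v"
  using rg connected_graph_lwalk[of F "amap \<phi>"] by (auto simp: representation_graph_def)

lemma dstep_unique:
  "dstep F (amap \<phi>) u x v \<Longrightarrow> dstep F (amap \<phi>) u x v' \<Longrightarrow> v = v'"
  using out_unique_edge in_unique_edge by (fastforce simp: dstep_def)

lemma walk_unique: "walk u p v \<Longrightarrow> walk u p v' \<Longrightarrow> v = v'"
  by (induction p arbitrary: u) (auto dest: dstep_unique)

text \<open>
  A cancelling pair of letters goes along an edge and straight back along the same edge, because the
  label determines the edge.
\<close>

lemma walk_normal_form: "walk u p v \<Longrightarrow> walk u (normal_form p) v"
proof (induction p arbitrary: v rule: rev_induct)
  case (snoc x p)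
  then obtain m where m: "walk u (normal_form p) m" "dstep F (amap \<phi>) m x v"
    by (auto simp: walk_snoc)
  let ?w = "fold push p []"
  have w: "normal_form p = rev ?w" "reduced ?w"
    using reduced_normal_form[of p] by (simp_all add: normal_form_def del: successively_rev)
  show ?case
  proof (cases "?w \<noteq> [] \<and> hd ?w = inv_letter x")
    case True
    then obtain w' where w': "?w = inv_letter x # w'" by (cases ?w) auto
    obtain m' where m': "walk u (rev w') m'" "dstep F (amap \<phi>) m' (inv_letter x) m"
      using m(1) unfolding w(1) w' by (auto simp: walk_snoc)
    then have "m' = v" using dstep_inv_letter[OF m'(2)] m(2) dstep_unique by auto
    then show ?thesis using m' w w' by (simp add: normal_form_def push_def)
  next
    case False
    then have "normal_form (p @ [x]) = normal_form p @ [x]"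
      using w by (auto simp: normal_form_def push_def)
    then show ?thesis using m by (auto simp: walk_snoc)
  qed
qed (simp add: normal_form_def)

lemma walk_ends_same_vertex:
  "walk u p x \<Longrightarrow> walk v p y \<Longrightarrow> vmap \<phi> u = vmap \<phi> v \<Longrightarrow> vmap \<phi> x = vmap \<phi> y"
proof (induction p arbitrary: u v)
  case (Cons z p)
  then obtain m n where mn: "dstep F (amap \<phi>) u z m" "dstep F (amap \<phi>) v z n" "walk m p x" "walk n p y"
    by auto
  have "vmap \<phi> m = vmap \<phi> n"
    using mn(1,2) unfolding dstep_def by (auto simp: hom(3,4)[symmetric])
  then show ?case using Cons.IH mn by blast
qed simp

text \<open>
  In the tree this says that some automorphism over \<open>E\<close> moves \<open>u\<close> to \<open>v\<close>; the last clause of the next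
  definition is invariance under that automorphism, which moves \<open>x\<close> to \<open>y\<close> and \<open>x'\<close> to \<open>y'\<close>.
\<close>

definition same_walks :: "'w \<Rightarrow> 'w \<Rightarrow> bool" where
  "same_walks u v \<longleftrightarrow> (\<forall>p. (\<exists>x. walk u p x) \<longleftrightarrow> (\<exists>y. walk v p y))"

definition invariant_order :: "('w \<Rightarrow> 'w \<Rightarrow> bool) \<Rightarrow> bool" where
  "invariant_order R \<longleftrightarrow> irreflp R \<and> transp R \<and> totalp_on (verts F) R \<and>
     (\<forall>u v p p' x x' y y'. same_walks u v \<longrightarrow> walk u p x \<longrightarrow> walk u p' x' \<longrightarrow>
        walk v p y \<longrightarrow> walk v p' y' \<longrightarrow> R x x' \<longrightarrow> R y y')"

lemma invariant_order_converse: "invariant_order R \<Longrightarrow> invariant_order R\<inverse>\<inverse>"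
  unfolding invariant_order_def by (auto simp: totalp_on_def)

definition turn_less :: "'w \<Rightarrow> 'w \<Rightarrow> bool" where
  "turn_less u v \<longleftrightarrow> (\<exists>p. reduced p \<and> walk u p v \<and> 0 < weight p)"

text \<open>
  By \<open>weight_tripod\<close>, two positive integer weights force the weight of the third side of the tripod to be
  positive.
\<close>

lemma transp_turn_less: "transp turn_less"
proof (rule transpI)
  fix u v z assume "turn_less u v" "turn_less v z"
  then obtain p r where p: "reduced p" "walk u p v" "0 < weight p"
    and r: "reduced r" "walk v r z" "0 < weight r" by (auto simp: turn_less_def)
  obtain c p' q where d: "p = c @ p'" "r = inv_word p' @ q" "reduced (c @ q)"
    using reduced_product_decomposition[OF p(1) r(1)] by blast
  obtain m where m: "walk u c m" "walk m p' v" using p(2) d(1) by (auto simp: walk_append)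
  obtain m' where m': "walk v (inv_word p') m'" "walk m' q z" using r(2) d(2) by (auto simp: walk_append)
  have "m' = m" using walk_unique[OF m'(1) walk_inv_word[OF m(2)]] .
  then have "walk u (c @ q) z" using m m' by (auto simp: walk_append)
  moreover have "0 < weight (c @ q)" using weight_tripod[of c p' q] p(3) r(3) d by simp
  ultimately show "turn_less u z" using d(3) by (auto simp: turn_less_def)
qed

end

text \<open>
  Representation graphs whose underlying graph is a tree.
\<close>

locale simply_connected_rep = bisep_rep B F \<phi>
  for B :: "('v,'e) bisep_graph" and F :: "('w,'f) pre_digraph" and \<phi> +
  assumes closed_walk: "walk u p u \<Longrightarrow> normal_form p = []"
begin

lemma invariant_order_turn_less: "invariant_order turn_less"
  unfolding invariant_order_def
proof (intro conjI allI impI)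
  show "irreflp turn_less"
  proof (rule irreflpI, rule notI)
    fix u assume "turn_less u u"
    then obtain p where "reduced p" "walk u p u" "0 < weight p" by (auto simp: turn_less_def)
    then show False using closed_walk[of u p] by (simp add: normal_form_reduced)
  qed
  show "transp turn_less" by (rule transp_turn_less)
  show "totalp_on (verts F) turn_less"
  proof (rule totalp_onI)
    fix u v assume uv: "u \<in> verts F" "v \<in> verts F" "u \<noteq> v"
    obtain l where "walk u l v" using walk_exists uv by blast
    then obtain p where p: "reduced p" "walk u p v"
      using walk_normal_form reduced_normal_form by blast
    have "p \<noteq> []" using p(2) uv(3) by auto
    then have "weight p \<noteq> 0" using p(1) weight_reduced_nonzero by blast
    moreover have "weight (inv_word p) = - weight p" by (rule turning_between_inv_word)
    ultimately show "turn_less u v \<or> turn_less v u"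
      using p walk_inv_word[OF p(2)] unfolding turn_less_def
      by (metis neg_0_less_iff_less linorder_neqE reduced_inv_word)
  qed
  fix u v p p' x x' y y'
  assume sw: "same_walks u v" and u: "walk u p x" "walk u p' x'" and v: "walk v p y" "walk v p' y'"
    and "turn_less x x'"
  then obtain q where q: "reduced q" "walk x q x'" "0 < weight q" by (auto simp: turn_less_def)
  have "walk u (p @ q) x'" using u q walk_append by blast
  then obtain z where z: "walk v (p @ q) z" using sw by (auto simp: same_walks_def)
  then have yz: "walk y q z" using walk_unique[OF v(1)] by (auto simp: walk_append)
  (* The translates of x and x' are joined by the walk labelled q as well: its end z is y', because
     the label of the closed walk at x' reduces to the empty word. *)
  let ?l = "inv_word p' @ p @ q"
  have "normal_form ?l = []"
    using closed_walk[of x' ?l] walk_inv_word[OF u(2)] \<open>walk u (p @ q) x'\<close> walk_append by blast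
  moreover have "walk y' ?l z" using walk_inv_word[OF v(2)] z walk_append by blast
  ultimately have "y' = z" using walk_normal_form[of y' ?l z] by simp
  then show "turn_less y y'" using q yz by (auto simp: turn_less_def)
qed

end

section \<open>Walks acting on submodules\<close>

context bisep_rep
begin

abbreviation submodule :: "('w \<Rightarrow>\<^sub>0 'k::field) set \<Rightarrow> bool" where
  "submodule N \<equiv> right_submodule (kcarrier (Lalg B)) (Vaction B F \<phi>) (Vspace F) N"

text \<open>
  Reduces the module action, which is defined through a unique homomorphism, to the action of
  representatives in the free algebra.
\<close>

lemma Vaction_coset:
  assumes "a \<in> free_algebra (L_gens B)" "x \<in> Vspace F"
  shows "Vaction B F \<phi> x (coset (L_gens B) (L_rels B) a) = act a x"
proof -
  have "pi_hom B F \<phi> = (pi0 :: ('v,'e,'a) Lfree set \<Rightarrow> _)"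
    using is_pi_unique is_pi_pi_hom[OF bs rg] is_pi_pi0 by blast
  then show ?thesis using assms by (simp add: Vaction_def pi0_coset)
qed

lemma submodule_act:
  assumes "submodule N" "x \<in> N" "a \<in> free_algebra (L_gens B)"
  shows "act a x \<in> N"
  using assms Vaction_coset[OF assms(3), of x] unfolding right_submodule_def carrier_L by force

lemma submodule_add: "submodule N \<Longrightarrow> x \<in> N \<Longrightarrow> y \<in> N \<Longrightarrow> x + y \<in> N"
  unfolding right_submodule_def by (metis diff_0 diff_minus_eq_add)

lemma submodule_sum: "submodule N \<Longrightarrow> (\<And>i. i \<in> A \<Longrightarrow> f i \<in> N) \<Longrightarrow> sum f A \<in> N"
  by (induction A rule: infinite_finite_induct) (auto intro: submodule_add simp: right_submodule_def)

lemma lookup_vertex_act: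
  "Poly_Mapping.lookup (lin_ext (sigma F \<phi> (Inl v)) x) w = (if vmap \<phi> w = v then Poly_Mapping.lookup x w else 0)"
  by (induction x rule: poly_single_add_induct)
    (auto simp: lin_ext_add lookup_add lookup_single when_def)

text \<open>
  On the finitely many basis vectors that occur in \<open>x\<close>, the sum of the vertices below them acts as the
  identity, so \<open>c\<close> times this sum acts as multiplication by \<open>c\<close>.
\<close>

lemma submodule_scale:
  assumes N: "submodule N" and x: "x \<in> N"
  shows "scale c x \<in> N"
proof -
  let ?S = "vmap \<phi> ` Poly_Mapping.keys x"
  let ?a = "\<Sum>v\<in>?S. scale c (gen (Inl v))"
  have "x \<in> Vspace F" using assms by (auto simp: right_submodule_def)
  then have "?a \<in> free_algebra (L_gens B)"
    using hom(2) by (intro free_sum free_algebra_simps) (auto simp: L_gens_iff Vspace_def)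
  moreover have "act ?a x = scale c x"
  proof (rule poly_mapping_eqI)
    fix w
    have "(\<Sum>v\<in>?S. c * (if vmap \<phi> w = v then Poly_Mapping.lookup x w else 0)) = c * Poly_Mapping.lookup x w"
      by (cases "w \<in> Poly_Mapping.keys x") (auto simp: sum_distrib_left[symmetric] in_keys_iff)
    then show "Poly_Mapping.lookup (act ?a x) w = Poly_Mapping.lookup (scale c x) w"
      by (simp add: rho_sum_left rho_scale_left lookup_sum lookup_vertex_act del: sigma.simps)
  qed
  ultimately show ?thesis using submodule_act[OF N x] by metis
qed

definition walk_act :: "'e dedge list \<Rightarrow> ('w \<Rightarrow>\<^sub>0 'k::field) \<Rightarrow> ('w \<Rightarrow>\<^sub>0 'k)" where
  "walk_act p = wact (sigma F \<phi>) (map Inr p)"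

lemma sigma_dstep: "dstep F (amap \<phi>) u x v \<Longrightarrow> sigma F \<phi> (Inr x) u = Poly_Mapping.single v 1"
  unfolding dstep_def
  by (auto simp: sigma_edge sigma_ghost simp del: sigma.simps)

lemma sigma_no_dstep: "(\<And>v. \<not> dstep F (amap \<phi>) u x v) \<Longrightarrow> sigma F \<phi> (Inr x) u = 0"
proof (cases x)
  case (Edge e)
  assume "\<And>v. \<not> dstep F (amap \<phi>) u x v"
  then show ?thesis unfolding Edge by (intro sigma_edge_0) (auto simp: dstep_def)
next
  case (Ghost e)
  assume "\<And>v. \<not> dstep F (amap \<phi>) u x v"
  then show ?thesis unfolding Ghost by (intro sigma_ghost_0) (auto simp: dstep_def)
qed

lemma walk_act_add: "walk_act p (x + y) = walk_act p x + walk_act p y"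
  and walk_act_scale: "walk_act p (scale c x) = scale c (walk_act p x)"
  by (simp_all add: walk_act_def wact_add wact_scale)

lemma walk_act_zero [simp]: "walk_act p 0 = 0"
  using walk_act_scale[of p 0 0] by simp

lemma lookup_walk_act_basis:
  "u \<in> verts F \<Longrightarrow>
    Poly_Mapping.lookup (walk_act p (Poly_Mapping.single u c)) y = (if walk u p y then c else 0)"
proof (induction p arbitrary: u)
  case Nil
  then show ?case by (simp add: walk_act_def lookup_single when_def)
next
  case (Cons x p)
  show ?case
  proof (cases "\<exists>v. dstep F (amap \<phi>) u x v")
    case True
    then obtain v where v: "dstep F (amap \<phi>) u x v" by blast
    then have "walk u (x # p) y \<longleftrightarrow> walk v p y" using dstep_unique by auto
    moreover have "walk_act (x # p) (Poly_Mapping.single u c) = walk_act p (Poly_Mapping.single v c)"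
      by (simp add: walk_act_def sigma_dstep[OF v] del: sigma.simps)
    ultimately show ?thesis using Cons.IH[of v] wf_digraph.dstep_verts[OF wfF v] by simp
  next
    case False
    then have "walk_act (x # p) (Poly_Mapping.single u c) = walk_act p 0"
      by (simp add: walk_act_def sigma_no_dstep del: sigma.simps)
    then show ?thesis using False by simp
  qed
qed

lemma walk_act_basis:
  assumes "walk u p v"
  shows "walk_act p (Poly_Mapping.single u c) = Poly_Mapping.single v c"
proof (rule poly_mapping_eqI)
  fix y
  have "walk u p y \<longleftrightarrow> v = y" using assms walk_unique by blast
  then show "Poly_Mapping.lookup (walk_act p (Poly_Mapping.single u c)) y = Poly_Mapping.lookup (Poly_Mapping.single v c) y"
    using walk_verts[OF assms] by (simp add: lookup_walk_act_basis lookup_single when_def)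
qed

lemma lookup_walk_act:
  assumes "x \<in> Vspace F"
  shows "Poly_Mapping.lookup (walk_act p x) y =
    (\<Sum>v\<in>Poly_Mapping.keys x. if walk v p y then Poly_Mapping.lookup x v else 0)"
proof -
  have "walk_act p (sum f A) = (\<Sum>i\<in>A. walk_act p (f i))" for A and f :: "'w \<Rightarrow> ('w \<Rightarrow>\<^sub>0 'a)"
    by (induction A rule: infinite_finite_induct) (auto simp: walk_act_add)
  then have "walk_act p x = (\<Sum>v\<in>Poly_Mapping.keys x. walk_act p (Poly_Mapping.single v (Poly_Mapping.lookup x v)))"
    using sum_singles[of x] by (metis (no_types, lifting) mult.right_neutral scale_single sum.cong)
  then show ?thesis
    using assms by (auto simp: lookup_sum Vspace_def lookup_walk_act_basis intro!: sum.cong)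
qed

text \<open>
  Walking back is deterministic as well, so a walk acts on the basis as a partial injection and the
  coefficients of different basis vectors do not mix.
\<close>

lemma lookup_walk_act_end:
  assumes "x \<in> Vspace F" "walk v p y"
  shows "Poly_Mapping.lookup (walk_act p x) y = Poly_Mapping.lookup x v"
proof -
  have "walk u p y \<longleftrightarrow> u = v" for u
    using assms(2) walk_inv_word walk_unique by blast
  then show ?thesis using assms(1) by (simp add: lookup_walk_act in_keys_iff)
qed

lemma lookup_walk_act_zero:
  assumes "x \<in> Vspace F" "\<And>v. v \<in> Poly_Mapping.keys x \<Longrightarrow> \<not> walk v p y"
  shows "Poly_Mapping.lookup (walk_act p x) y = 0"
  unfolding lookup_walk_act[OF assms(1)] using assms(2) by (intro sum.neutral) auto

lemma submodule_walk_act: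
  assumes N: "submodule N" and x: "x \<in> N" and p: "walk u p v"
  shows "walk_act p x \<in> N"
  using x p
proof (induction p arbitrary: u x)
  case (Cons y p)
  then obtain m where m: "dstep F (amap \<phi>) u y m" "walk m p v" by auto
  have "Inr y \<in> L_gens B" using m(1) hom(1) by (auto simp: dstep_def L_gens_iff)
  then have "act (gen (Inr y)) x \<in> N"
    by (intro submodule_act[OF N Cons.prems(1)] free_algebra_simps(5))
  then show ?case using Cons.IH[OF _ m(2)] by (simp add: walk_act_def del: sigma.simps)
qed (simp add: walk_act_def)

lemma submodule_eq_Vspace:
  assumes N: "submodule N" and w: "Poly_Mapping.single w 1 \<in> N" and F: "w \<in> verts F"
  shows "N = Vspace F"
proof
  show "N \<subseteq> Vspace F" using N by (simp add: right_submodule_def)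
  show "Vspace F \<subseteq> N"
  proof
    fix x :: "'w \<Rightarrow>\<^sub>0 'a" assume x: "x \<in> Vspace F"
    have "Poly_Mapping.single v 1 \<in> N" if "v \<in> Poly_Mapping.keys x" for v
    proof -
      have "v \<in> verts F" using that x by (auto simp: Vspace_def)
      then obtain p where "walk w p v" using walk_exists[OF F] by blast
      then show ?thesis using submodule_walk_act[OF N w] walk_act_basis by metis
    qed
    then have "(\<Sum>v\<in>Poly_Mapping.keys x. scale (Poly_Mapping.lookup x v) (Poly_Mapping.single v 1)) \<in> N"
      using N by (intro submodule_sum submodule_scale)
    then show "x \<in> N" unfolding sum_singles .
  qed
qed

section \<open>Components of a vertex in a decomposition\<close>

context
  fixes N1 N2 :: "('w \<Rightarrow>\<^sub>0 'k::field) set" and w :: 'w and a b :: "'w \<Rightarrow>\<^sub>0 'k"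
  assumes N: "submodule N1" "submodule N2" "N1 \<inter> N2 = {0}"
    and w: "w \<in> verts F" and ab: "a \<in> N1" "b \<in> N2" "Poly_Mapping.single w 1 = a + b"
begin

lemma component_in_Vspace: "a \<in> Vspace F"
  using N(1) ab(1) by (auto simp: right_submodule_def)

text \<open>
  Applied to \<open>x = a r\<close> and \<open>y = b r\<close>: an element \<open>r\<close> that kills \<open>w\<close> also kills \<open>a\<close>.
\<close>

lemma component_zero:
  assumes "x \<in> N1" "y \<in> N2" "x + y = 0"
  shows "x = 0"
proof -
  have "0 - y \<in> N2" using N(2) assms(2) unfolding right_submodule_def by blast
  moreover have "0 - y = x" using assms(3) by (metis diff_0 eq_neg_iff_add_eq_0)
  ultimately show ?thesis using N(3) assms(1) by auto
qed

lemma component_vertex: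
  assumes v: "v \<in> Poly_Mapping.keys a"
  shows "vmap \<phi> v = vmap \<phi> w"
proof (rule ccontr)
  assume ne: "vmap \<phi> v \<noteq> vmap \<phi> w"
  let ?g = "gen (Inl (vmap \<phi> v)) :: ('v,'e,'k) Lfree"
  have "?g \<in> free_algebra (L_gens B)"
    using v hom(2) component_in_Vspace by (intro free_algebra_simps(5)) (auto simp: L_gens_iff Vspace_def)
  then have "act ?g a \<in> N1" "act ?g b \<in> N2"
    by (rule submodule_act[OF N(1) ab(1)], rule submodule_act[OF N(2) ab(2)])
  moreover have "act ?g a + act ?g b = 0"
    unfolding rho_add_right[symmetric] ab(3)[symmetric] using ne by simp
  ultimately have "act ?g a = 0" by (rule component_zero)
  then show False using lookup_vertex_act[of "vmap \<phi> v" a v] v by (simp add: in_keys_iff)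
qed

lemma component_walk:
  assumes v: "v \<in> Poly_Mapping.keys a" and p: "walk v p y"
  shows "\<exists>y. walk w p y"
proof (rule ccontr)
  assume "\<not> ?thesis"
  then have "walk_act p (Poly_Mapping.single w (1::'k)) = 0"
    using w by (intro poly_mapping_eqI) (auto simp: lookup_walk_act_basis)
  then have "walk_act p a + walk_act p b = 0" unfolding ab(3) walk_act_add .
  then have "walk_act p a = 0"
    using component_zero submodule_walk_act N ab p by blast
  then show False
    using lookup_walk_act_end[OF component_in_Vspace p] v by (simp add: in_keys_iff)
qed

text \<open>
  If \<open>w\<close> has a step with label \<open>e\<close> in a block \<open>X\<close> of the partition, then \<open>v\<close>, lying over the same vertex
  of \<open>E\<close>, has a step with some label in \<open>X\<close>.  By \<open>component_walk\<close> this label is also available at \<open>w\<close>,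
  where it must be \<open>e\<close> by uniqueness.
\<close>

lemma component_same_walks:
  assumes v: "v \<in> Poly_Mapping.keys a"
  shows "same_walks w v"
proof -
  have "\<exists>y. walk v p y" if "walk w p x" for p x
    using that
  proof (induction p arbitrary: x rule: rev_induct)
    case Nil
    then show ?case using v component_in_Vspace by (auto simp: Vspace_def)
  next
    case (snoc z p)
    then obtain m where m: "walk w p m" "dstep F (amap \<phi>) m z x" by (auto simp: walk_snoc)
    then obtain n where n: "walk v p n" using snoc.IH by blast
    have mn: "vmap \<phi> m = vmap \<phi> n"
      using walk_ends_same_vertex[OF m(1) n] component_vertex[OF v] by simp
    have verts: "m \<in> verts F" "n \<in> verts F" "vmap \<phi> m \<in> verts E" using walk_verts m n hom(2) by blast+
    have letter: "\<exists>k. dstep F (amap \<phi>) m z' k" if "dstep F (amap \<phi>) n z' k'" for z' k'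
      using component_walk[OF v, of "p @ [z']"] n that walk_unique[OF m(1)] unfolding walk_snoc by blast
    obtain f where f: "f \<in> arcs F" "z = Edge (amap \<phi> f) \<and> tail F f = m \<or> z = Ghost (amap \<phi> f) \<and> head F f = m"
      using m(2) by (auto simp: dstep_def)
    from f(2) have "\<exists>k. dstep F (amap \<phi>) n z k"
    proof
      assume z: "z = Edge (amap \<phi> f) \<and> tail F f = m"
      then have "amap \<phi> f \<in> out_arcs E (vmap \<phi> m)" using f(1) hom(1,3) by auto
      then obtain X where X: "X \<in> Cpart B (vmap \<phi> m)" "amap \<phi> f \<in> X"
        using partition_onD1[OF partC[OF verts(3)]] by blast
      then obtain g where g: "g \<in> out_arcs F n" "amap \<phi> g \<in> X"
        using rg_out[OF verts(2), of X] mn by auto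
      then have gn: "dstep F (amap \<phi>) n (Edge (amap \<phi> g)) (head F g)" by (auto simp: dstep_def)
      obtain k where "dstep F (amap \<phi>) m (Edge (amap \<phi> g)) k" using letter[OF gn] by blast
      then obtain f' where f': "f' \<in> out_arcs F m" "amap \<phi> f' = amap \<phi> g" by (auto simp: dstep_def)
      then have "f' = f"
        using out_unique[of f' m f X] CallI[OF X(1) verts(3)] X(2) g(2) z f(1) by simp
      then show ?thesis using gn f' z by auto
    next
      assume z: "z = Ghost (amap \<phi> f) \<and> head F f = m"
      then have "amap \<phi> f \<in> in_arcs E (vmap \<phi> m)" using f(1) hom(1,4) by auto
      then obtain Y where Y: "Y \<in> Dpart B (vmap \<phi> m)" "amap \<phi> f \<in> Y"
        using partition_onD1[OF partD[OF verts(3)]] by blast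
      then obtain g where g: "g \<in> in_arcs F n" "amap \<phi> g \<in> Y"
        using rg_in[OF verts(2), of Y] mn by auto
      then have gn: "dstep F (amap \<phi>) n (Ghost (amap \<phi> g)) (tail F g)" by (auto simp: dstep_def)
      obtain k where "dstep F (amap \<phi>) m (Ghost (amap \<phi> g)) k" using letter[OF gn] by blast
      then obtain f' where f': "f' \<in> in_arcs F m" "amap \<phi> f' = amap \<phi> g" by (auto simp: dstep_def)
      then have "f' = f"
        using in_unique[of f' m f Y] DallI[OF Y(1) verts(3)] Y(2) g(2) z f(1) by simp
      then show ?thesis using gn f' z by auto
    qed
    then show ?case using n walk_snoc by blast
  qed
  then show ?thesis using component_walk[OF v] unfolding same_walks_def by blast
qed

text \<open>
  This expresses that the projection to \<open>N\<^sub>1\<close> is idempotent and compatible with walks: the basis vector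
  \<open>u\<close> is the image of \<open>w\<close> under \<open>p u\<close>, so its component in \<open>N\<^sub>1\<close> is the image of \<open>a\<close>.
\<close>

lemma component_expansion:
  assumes p: "\<And>u. u \<in> Poly_Mapping.keys a \<Longrightarrow> walk w (p u) u"
  shows "a = (\<Sum>u\<in>Poly_Mapping.keys a. scale (Poly_Mapping.lookup a u) (walk_act (p u) a))"
proof -
  let ?c = "\<lambda>x. \<Sum>u\<in>Poly_Mapping.keys a. scale (Poly_Mapping.lookup a u) (walk_act (p u) x)"
  have in_N: "?c x \<in> N'" if "submodule N'" "x \<in> N'" for N' x
    using that p by (intro submodule_sum submodule_scale submodule_walk_act)
  have "a = (\<Sum>u\<in>Poly_Mapping.keys a. scale (Poly_Mapping.lookup a u) (Poly_Mapping.single u 1))"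
    by (rule sum_singles[symmetric])
  also have "\<dots> = ?c (a + b)"
    unfolding ab(3)[symmetric] by (rule sum.cong) (simp_all only: walk_act_basis[OF p])
  also have "\<dots> = ?c a + ?c b" by (simp add: walk_act_add scale_add sum.distrib)
  finally have "a = ?c a + ?c b" .
  moreover have "(x - a) + y = 0" if "a = x + y" for x y unfolding that by simp
  ultimately have "(?c a - a) + ?c b = 0" by blast
  moreover have "?c a - a \<in> N1" using in_N[OF N(1) ab(1)] N(1) ab(1) unfolding right_submodule_def by blast
  ultimately have "?c a - a = 0" using component_zero in_N[OF N(2) ab(2)] by blast
  then show ?thesis by simp
qed

text \<open>
  The unique product argument.  Write \<open>e v u\<close> for the end of the walk \<open>p u\<close> started at \<open>v\<close>, that is, the
  product of \<open>v\<close> and \<open>u\<close>.  With \<open>u\<^sub>0\<close> the largest vertex in the support of \<open>a\<close>, the largest of all the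
  products is of the form \<open>z = e v u\<^sub>0\<close>, and no other product equals it.  Hence \<open>z\<close> occurs in \<open>a\<close> by
  \<open>component_expansion\<close>, so it is at most \<open>u\<^sub>0\<close>.  But \<open>w < u\<^sub>0\<close> translates to \<open>u\<^sub>0 < e u\<^sub>0 u\<^sub>0\<close>, which is at
  most \<open>z\<close>.
\<close>

lemma component_not_above:
  assumes R: "invariant_order R" and u: "u \<in> Poly_Mapping.keys a"
  shows "\<not> R w u"
proof
  assume wu: "R w u"
  let ?A = "Poly_Mapping.keys a"
  have irrefl: "\<not> R x x" for x
    using R unfolding invariant_order_def by (auto dest: irreflpD)
  have trans: "R x y \<Longrightarrow> R y z \<Longrightarrow> R x z" for x y z
    using R unfolding invariant_order_def by (auto dest: transpD)
  have total: "x \<in> verts F \<Longrightarrow> y \<in> verts F \<Longrightarrow> x = y \<or> R x y \<or> R y x" for x y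
    using R unfolding invariant_order_def by (auto dest: totalp_onD)
  have invar: "R y y'" if "v \<in> ?A" "walk w p x" "walk w p' x'" "walk v p y" "walk v p' y'" "R x x'"
    for v p p' x x' y y'
    using R that component_same_walks[OF that(1)] unfolding invariant_order_def by blast
  have AV: "v \<in> verts F" if "v \<in> ?A" for v using that component_in_Vspace by (auto simp: Vspace_def)
  have maxi: "\<exists>m\<in>S. \<forall>x\<in>S. x = m \<or> R x m" if S: "finite S" "S \<noteq> {}" "S \<subseteq> verts F" for S
  proof -
    have "asymp_on S R" using irrefl trans by (auto intro!: asymp_onI)
    moreover have "transp_on S R" using trans by (auto intro!: transp_onI)
    ultimately obtain m where "m \<in> S" "\<forall>x\<in>S. x \<noteq> m \<longrightarrow> \<not> R m x"
      using Finite_Set.bex_max_element[OF S(1)] S(2) by blast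
    then show ?thesis using total S(3) by blast
  qed
  have "\<exists>p. walk w p v" if "v \<in> ?A" for v using walk_exists w AV that by blast
  then obtain p where p: "\<And>v. v \<in> ?A \<Longrightarrow> walk w (p v) v" by metis
  obtain u0 where u0: "u0 \<in> ?A" "\<And>v. v \<in> ?A \<Longrightarrow> v = u0 \<or> R v u0"
    using maxi[of ?A] u AV by (metis empty_iff finite_keys subsetI)
  have "\<exists>y. walk v (p u') y" if "v \<in> ?A" "u' \<in> ?A" for v u'
    using component_same_walks[OF that(1)] p[OF that(2)] unfolding same_walks_def by blast
  then obtain e where e: "\<And>v u'. v \<in> ?A \<Longrightarrow> u' \<in> ?A \<Longrightarrow> walk v (p u') (e v u')" by metis
  obtain z where z: "z \<in> (\<lambda>v. e v u0) ` ?A" "\<And>v. v \<in> ?A \<Longrightarrow> e v u0 = z \<or> R (e v u0) z"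
  proof -
    let ?S = "(\<lambda>v. e v u0) ` ?A"
    have "?S \<subseteq> verts F" using e u0(1) walk_verts by blast
    moreover have "finite ?S" "?S \<noteq> {}" using u by auto
    ultimately obtain m where "m \<in> ?S" "\<forall>x\<in>?S. x = m \<or> R x m" using maxi[of ?S] by blast
    then show ?thesis by (intro that[of m]) auto
  qed
  obtain v0 where v0: "v0 \<in> ?A" "z = e v0 u0" using z(1) by blast
  have "Poly_Mapping.lookup (walk_act (p u') a) z = 0" if u': "u' \<in> ?A" "u' \<noteq> u0" for u'
  proof (rule lookup_walk_act_zero[OF component_in_Vspace], rule notI)
    fix v assume v: "v \<in> ?A" "walk v (p u') z"
    have "R z (e v u0)"
      using invar[OF v(1) p[OF u'(1)] p[OF u0(1)] v(2) e[OF v(1) u0(1)]] u0(2)[OF u'(1)] u'(2) by blast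
    then show False using z(2)[OF v(1)] irrefl trans by metis
  qed
  then have zero: "(\<Sum>u'\<in>?A - {u0}. Poly_Mapping.lookup a u' * Poly_Mapping.lookup (walk_act (p u') a) z) = 0"
    by (intro sum.neutral) auto
  have "Poly_Mapping.lookup a z =
      Poly_Mapping.lookup (\<Sum>u'\<in>?A. scale (Poly_Mapping.lookup a u') (walk_act (p u') a)) z"
    by (rule arg_cong[OF component_expansion[OF p]])
  also have "\<dots> = (\<Sum>u'\<in>?A. Poly_Mapping.lookup a u' * Poly_Mapping.lookup (walk_act (p u') a) z)"
    by (simp add: lookup_sum)
  also have "\<dots> = Poly_Mapping.lookup a u0 * Poly_Mapping.lookup (walk_act (p u0) a) z"
    unfolding sum.remove[OF finite_keys u0(1)] zero by simp
  also have "\<dots> = Poly_Mapping.lookup a u0 * Poly_Mapping.lookup a v0"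
    using lookup_walk_act_end[OF component_in_Vspace e[OF v0(1) u0(1)]] v0(2) by simp
  finally have "z \<in> ?A" using u0(1) v0(1) by (simp add: in_keys_iff)
  then have "z = u0 \<or> R z u0" by (rule u0(2))
  moreover have "R w u0" using wu u0(2)[OF u] trans by blast
  then have "R u0 (e u0 u0)"
    using invar[OF u0(1), of "[]" w "p u0" u0 u0 "e u0 u0"] w AV p[OF u0(1)] e[OF u0(1) u0(1)] u0(1) by simp
  ultimately show False using z(2)[OF u0(1)] irrefl trans by metis
qed

end

end

context simply_connected_rep
begin

text \<open>
  By \<open>component_not_above\<close> for the order and its converse, \<open>a\<close> is a scalar multiple of \<open>w\<close>.
\<close>

lemma decomposition_vertex:
  fixes N1 N2 :: "('w \<Rightarrow>\<^sub>0 'k::field) set"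
  assumes N: "submodule N1" "submodule N2" "N1 \<inter> N2 = {0}"
    and w: "w \<in> verts F" "Poly_Mapping.single w 1 = a + b" "a \<in> N1" "b \<in> N2"
  shows "Poly_Mapping.single w 1 \<in> N1 \<or> Poly_Mapping.single w 1 \<in> N2"
proof (cases "a = 0")
  case True
  then show ?thesis using w by simp
next
  case False
  have "u = w" if u: "u \<in> Poly_Mapping.keys a" for u
  proof -
    note na = component_not_above[OF N w(1,3,4,2) _ u]
    have "\<not> turn_less w u" "\<not> turn_less u w"
      using na[OF invariant_order_turn_less] na[OF invariant_order_converse[OF invariant_order_turn_less]]
      by simp_all
    moreover have "u \<in> verts F" using u component_in_Vspace[OF N w(1,3,4,2)] by (auto simp: Vspace_def)
    ultimately show ?thesis
      using invariant_order_turn_less w(1) unfolding invariant_order_def by (auto dest: totalp_onD)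
  qed
  then have "a = Poly_Mapping.single w (Poly_Mapping.lookup a w)"
    by (intro poly_mapping_eqI) (auto simp: lookup_single when_def in_keys_iff)
  moreover have "Poly_Mapping.lookup a w \<noteq> 0" using False calculation by auto
  ultimately have "scale (inverse (Poly_Mapping.lookup a w)) a = Poly_Mapping.single w 1"
    by (metis left_inverse scale_single)
  then show ?thesis using submodule_scale[OF N(1) w(3)] by metis
qed

lemma indecomposable_Vspace:
  "indecomposable_right_module (kcarrier (Lalg B :: (('v,'e,'k::field) Lfree set, 'k) kalgebra))
     (Vaction B F \<phi>) (Vspace F)"
proof -
  obtain w where w: "w \<in> verts F" using rg by (auto simp: representation_graph_def connected_graph_def)
  let ?w = "Poly_Mapping.single w (1::'k)"
  have wV: "?w \<in> Vspace F" using w by (simp add: Vspace_simps)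
  show ?thesis unfolding indecomposable_right_module_def
  proof (intro conjI notI)
    assume "Vspace F = {0 :: 'w \<Rightarrow>\<^sub>0 'k}"
    then have "?w = 0" using wV by blast
    then show False by (metis lookup_single_eq lookup_zero zero_neq_one)
  next
    assume "\<exists>N1 N2 :: ('w \<Rightarrow>\<^sub>0 'k) set. submodule N1 \<and> submodule N2 \<and> N1 \<noteq> {0} \<and> N2 \<noteq> {0} \<and>
      N1 \<inter> N2 = {0} \<and> {x + y |x y. x \<in> N1 \<and> y \<in> N2} = Vspace F"
    then obtain N1 N2 :: "('w \<Rightarrow>\<^sub>0 'k) set" where N: "submodule N1" "submodule N2" "N1 \<inter> N2 = {0}"
      and ne: "N1 \<noteq> {0}" "N2 \<noteq> {0}" and sum: "{x + y |x y. x \<in> N1 \<and> y \<in> N2} = Vspace F" by blast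
    obtain a b where "?w = a + b" "a \<in> N1" "b \<in> N2" using wV sum by blast
    then have "N1 = Vspace F \<or> N2 = Vspace F"
      using decomposition_vertex[OF N w] submodule_eq_Vspace[OF N(1) _ w] submodule_eq_Vspace[OF N(2) _ w]
      by blast
    moreover have "N1 \<subseteq> Vspace F" "N2 \<subseteq> Vspace F" using N by (auto simp: right_submodule_def)
    ultimately show False using N(3) ne by blast
  qed
qed

end

theorem theorem5p9:
  fixes B :: "('v,'e) bisep_graph"
    and \<C> :: "('w,'f,'v,'e) graph_over set"
    and T :: "('t,'g) pre_digraph"
    and \<zeta> :: "('t,'g,'v,'e) graph_map"
  assumes "bi_separated B"
    and "\<C> \<in> RG_components B"
    and "is_T_zeta \<C> T \<zeta>"
  shows "indecomposable_right_module
           (kcarrier (Lalg B :: (('v,'e,'k::field) Lfree set, 'k) kalgebra))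
           (Vaction B T \<zeta>) (Vspace T)"
proof -
  obtain F \<phi> \<tau> where F: "(F, \<phi>) \<in> \<C>" "universal_covering F T \<tau>" "\<zeta> = comp_map \<phi> \<tau>"
    using assms(3) by (auto simp: is_T_zeta_def)
  have "(F, \<phi>) \<in> RG B" using RG_component_subset[OF assms(2)] F(1) by blast
  then have conn: "connected_graph F" by (simp add: RG_def representation_graph_def)
  interpret simply_connected_rep B T \<zeta>
  proof
    show "bi_separated B" by fact
    show "representation_graph B T \<zeta>" using is_T_zeta_representation_graph assms by blast
    fix u p assume "lwalk T (amap \<zeta>) u p u"
    then show "normal_form p = []"
      using universal_covering_closed_lwalk[OF conn F(2), of "amap \<phi>" u p] F(3) by (simp add: comp_map_def)
  qed
  show ?thesis by (rule indecomposable_Vspace)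
qed

end
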